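(* Let $0<a\le1$, $H=T^a$, $\alpha>0$, and let $f$ be a real-valued even function with $\hat f\in C_c^\infty(\mathbb{R})$ and $\operatorname{supp}\hat f\subset(-\alpha,\alpha)$. Let $w\ge0$ with $\int w=1$ and $\hat w$ compactly supported. Then for every integer $m$ with $2\le m<2a/\alpha$, as $T\to\infty$, $$\langle (N_f^{\mathrm{osc}})^m\rangle_{T,H}=\begin{cases}\dfrac{(2k)!}{k!\,2^k}\sigma_f^{2k}, & m=2k,\\[4pt] 0, & m=2k+1,\end{cases}\;+\;O\Big(\frac1{\log T}\Big),$$ where $\sigma_f^2=\int_{-\infty}^\infty\min(|u|,1)\,\hat f(u)^2\,du$.
   Context: $\hat f(u)=\int f(x)e^{-2\pi ixu}\,dx$. $\Lambda$ is the von Mangoldt function. For real $\tau$, $$N_f^{\mathrm{osc}}(\tau)=-\frac{1}{\log T}\sum_{n\ge2}\frac{\Lambda(n)}{\sqrt n}\hat f\Big(\frac{\log n}{\log T}\Big)\big(e^{i\tau\log n}+e^{-i\tau\log n}\big).$$ For a function $W$ of $\tau$, $\langle W\rangle_{T,H}=\int_{-\infty}^\infty W(\tau)w\big(\frac{\tau-T}{H}\big)\frac{d\tau}{H}$. *)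

theory Defs
  imports "HOL-Analysis.Analysis" "HOL-Number_Theory.Prime_Powers"
begin

definition fourier :: "(real \<Rightarrow> real) \<Rightarrow> real \<Rightarrow> complex" where
  "fourier f u = (LINT x|lborel. complex_of_real (f x) * exp (- 2 * pi * \<i> * complex_of_real (x * u)))"

definition smooth_fun :: "(real \<Rightarrow> complex) \<Rightarrow> bool" where
  "smooth_fun g \<longleftrightarrow>
     (\<forall>k x. ((deriv ^^ k) (\<lambda>t. Re (g t))) differentiable (at x)) \<and>
     (\<forall>k x. ((deriv ^^ k) (\<lambda>t. Im (g t))) differentiable (at x))"

definition supp :: "(real \<Rightarrow> complex) \<Rightarrow> real set" where
  "supp g = closure {u. g u \<noteq> 0}"

definition N_osc :: "(real \<Rightarrow> real) \<Rightarrow> real \<Rightarrow> real \<Rightarrow> complex" where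
  "N_osc f T \<tau> = - (1 / complex_of_real (ln T)) *
     (\<Sum>\<^sub>\<infinity>n\<in>{2::nat..}. (mangoldt n / complex_of_real (sqrt (real n))) *
        fourier f (ln (real n) / ln T) *
        (exp (\<i> * complex_of_real (\<tau> * ln (real n))) + exp (- \<i> * complex_of_real (\<tau> * ln (real n)))))"

definition wavg :: "(real \<Rightarrow> real) \<Rightarrow> real \<Rightarrow> real \<Rightarrow> (real \<Rightarrow> complex) \<Rightarrow> complex" where
  "wavg w T H W = (LINT \<tau>|lborel. W \<tau> * complex_of_real (w ((\<tau> - T) / H) / H))"

definition sigma2 :: "(real \<Rightarrow> real) \<Rightarrow> complex" where
  "sigma2 f = (LINT u|lborel. complex_of_real (min \<bar>u\<bar> 1) * (fourier f u)\<^sup>2)"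

end

theory Submission
  imports Defs "HOL-Library.Poly_Mapping" "HOL-Computational_Algebra.Formal_Power_Series"
    "HOL-Real_Asymp.Real_Asymp"
begin

text \<open>
  For fixed \<open>T\<close> the function \<open>N_osc f T\<close> is a trigonometric polynomial in \<open>\<tau>\<close> with frequencies
  \<open>\<plusminus>ln n\<close>, \<open>n \<le> T powr \<alpha>\<close>. The frequencies of its \<open>m\<close>-th power are \<open>ln (a / b)\<close> with
  \<open>a * b \<le> T powr (m * \<alpha>)\<close>, so the nonzero ones are at least \<open>T powr (- m * \<alpha> / 2) / 2\<close> in modulus.
  As \<open>m * \<alpha> / 2 < a\<close> and the Fourier transform of \<open>w\<close> has bounded support, averaging kills them
  for large \<open>T\<close>: only the constant term survives.

  By unique factorisation the contributions of different primes behave like independent random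
  variables under the constant term functional, so the exponential generating function of the
  constant terms is a product over primes. The factor of \<open>p\<close> is \<open>1 + v p * t\<^sup>2 / 2 + \<dots>\<close>, where the
  coefficient of \<open>t ^ s\<close> is \<open>O((ln p / (ln T * sqrt p)) ^ s)\<close>. Comparing with \<open>exp (v p * t\<^sup>2 / 2)\<close>
  factor by factor shows that the product is \<open>exp (V * t\<^sup>2 / 2)\<close> up to \<open>O(1 / ln T)\<close>, with
  \<open>V = (\<Sum>p. v p)\<close>, and Mertens' theorem with partial summation gives \<open>V = sigma2 f + O(1 / ln T)\<close>.
\<close>

section \<open>Trigonometric polynomials\<close>

text \<open>A trigonometric polynomial is represented by its finitely supported coefficient function on
  the group of frequencies, so that the ring structure is convolution.\<close>

abbreviation "coef \<equiv> Poly_Mapping.lookup"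
abbreviation "freqs \<equiv> Poly_Mapping.keys"
abbreviation "wave \<equiv> Poly_Mapping.single"

lemma sum_wave_coef: "(\<Sum>x\<in>freqs F. wave x (coef F x)) = F"
proof (rule poly_mapping_eqI)
  fix k
  have "coef (\<Sum>x\<in>freqs F. wave x (coef F x)) k = (\<Sum>x\<in>freqs F. if x = k then coef F x else 0)"
    by (auto simp: lookup_sum lookup_single when_def intro!: sum.cong)
  also have "\<dots> = coef F k"
    by (auto simp: in_keys_iff)
  finally show "coef (\<Sum>x\<in>freqs F. wave x (coef F x)) k = coef F k" .
qed

lemma mult_eq_sum_wave:
  fixes F G :: "'k::monoid_add \<Rightarrow>\<^sub>0 'a::semiring_0"
  shows "F * G = (\<Sum>x\<in>freqs F. \<Sum>y\<in>freqs G. wave (x + y) (coef F x * coef G y))"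
proof -
  have "F * G = (\<Sum>x\<in>freqs F. wave x (coef F x)) * (\<Sum>y\<in>freqs G. wave y (coef G y))"
    by (simp only: sum_wave_coef)
  also have "\<dots> = (\<Sum>x\<in>freqs F. \<Sum>y\<in>freqs G. wave (x + y) (coef F x * coef G y))"
    by (simp add: sum_product mult_single)
  finally show ?thesis .
qed

lemma coef_of_nat_mult:
  fixes F :: "'k::comm_monoid_add \<Rightarrow>\<^sub>0 'a::comm_semiring_1"
  shows "coef (of_nat n * F) x = of_nat n * coef F x"
  by (induction n) (simp_all add: lookup_add ring_distribs)

lemma freqs_power_subset:
  fixes F :: "'k::monoid_add \<Rightarrow>\<^sub>0 'a::semiring_1"
  assumes "0 \<in> A 0" and step: "\<And>k x y. x \<in> freqs F \<Longrightarrow> y \<in> A k \<Longrightarrow> x + y \<in> A (Suc k)"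
  shows "freqs (F ^ k) \<subseteq> A k"
proof (induction k)
  case 0
  show ?case using assms(1) by simp
next
  case (Suc k)
  show ?case
  proof
    fix z assume "z \<in> freqs (F ^ Suc k)"
    then obtain x y where "z = x + y" "x \<in> freqs F" "y \<in> freqs (F ^ k)"
      using keys_mult[of F "F ^ k"] by auto
    with Suc.IH show "z \<in> A (Suc k)" by (auto intro: step)
  qed
qed

definition trig_poly :: "(real \<Rightarrow>\<^sub>0 complex) \<Rightarrow> real \<Rightarrow> complex" where
  "trig_poly F \<tau> = (\<Sum>x\<in>freqs F. coef F x * cis (\<tau> * x))"

lemma trig_poly_0 [simp]: "trig_poly 0 \<tau> = 0"
  by (simp add: trig_poly_def)

lemma trig_poly_1 [simp]: "trig_poly 1 \<tau> = 1"
  by (simp add: trig_poly_def)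

lemma trig_poly_wave [simp]: "trig_poly (wave x z) \<tau> = z * cis (\<tau> * x)"
  by (simp add: trig_poly_def)

lemma trig_poly_add: "trig_poly (F + G) \<tau> = trig_poly F \<tau> + trig_poly G \<tau>"
proof -
  have superset: "trig_poly F' \<tau> = (\<Sum>x\<in>freqs F \<union> freqs G. coef F' x * cis (\<tau> * x))"
    if "freqs F' \<subseteq> freqs F \<union> freqs G" for F'
    unfolding trig_poly_def using that
    by (intro sum.mono_neutral_left) (auto simp: in_keys_iff)
  show ?thesis
    by (simp add: superset keys_add lookup_add ring_distribs sum.distrib)
qed

lemma trig_poly_sum: "trig_poly (\<Sum>i\<in>I. F i) \<tau> = (\<Sum>i\<in>I. trig_poly (F i) \<tau>)"
  by (induction I rule: infinite_finite_induct) (auto simp: trig_poly_add)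

lemma trig_poly_mult: "trig_poly (F * G) \<tau> = trig_poly F \<tau> * trig_poly G \<tau>"
proof -
  have "trig_poly (F * G) \<tau>
      = (\<Sum>x\<in>freqs F. \<Sum>y\<in>freqs G. coef F x * coef G y * cis (\<tau> * (x + y)))"
    by (subst mult_eq_sum_wave) (simp only: trig_poly_sum trig_poly_wave)
  also have "\<dots> = trig_poly F \<tau> * trig_poly G \<tau>"
    by (simp add: trig_poly_def sum_product cis_mult[symmetric] ring_distribs mult_ac)
  finally show ?thesis .
qed

lemma trig_poly_power: "trig_poly (F ^ m) \<tau> = trig_poly F \<tau> ^ m"
  by (induction m) (simp_all add: trig_poly_mult)

definition l1_norm :: "('k \<Rightarrow>\<^sub>0 'a::real_normed_vector) \<Rightarrow> real" where
  "l1_norm F = (\<Sum>x\<in>freqs F. norm (coef F x))"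

lemma l1_norm_nonneg: "l1_norm F \<ge> 0"
  by (simp add: l1_norm_def sum_nonneg)

lemma l1_norm_0 [simp]: "l1_norm 0 = 0"
  by (simp add: l1_norm_def)

lemma l1_norm_wave [simp]: "l1_norm (wave x z) = norm z"
  by (simp add: l1_norm_def)

lemma l1_norm_add: "l1_norm (F + G) \<le> l1_norm F + l1_norm G"
proof -
  have superset: "l1_norm F' = (\<Sum>x\<in>freqs F \<union> freqs G. norm (coef F' x))"
    if "freqs F' \<subseteq> freqs F \<union> freqs G" for F'
    unfolding l1_norm_def using that
    by (intro sum.mono_neutral_left) (auto simp: in_keys_iff)
  show ?thesis
    by (simp add: superset keys_add lookup_add flip: sum.distrib)
       (intro sum_mono norm_triangle_ineq)
qed

lemma l1_norm_sum: "l1_norm (\<Sum>i\<in>I. F i) \<le> (\<Sum>i\<in>I. l1_norm (F i))"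
  by (induction I rule: infinite_finite_induct) (auto intro: order_trans[OF l1_norm_add])

lemma l1_norm_mult:
  fixes F G :: "'k::monoid_add \<Rightarrow>\<^sub>0 'a::real_normed_algebra"
  shows "l1_norm (F * G) \<le> l1_norm F * l1_norm G"
proof -
  have "l1_norm (F * G)
      \<le> (\<Sum>x\<in>freqs F. \<Sum>y\<in>freqs G. l1_norm (wave (x + y) (coef F x * coef G y)))"
    by (subst mult_eq_sum_wave) (rule order_trans[OF l1_norm_sum] sum_mono l1_norm_sum)+
  also have "\<dots> \<le> (\<Sum>x\<in>freqs F. \<Sum>y\<in>freqs G. norm (coef F x) * norm (coef G y))"
    by (intro sum_mono) (simp add: norm_mult_ineq)
  also have "\<dots> = l1_norm F * l1_norm G"
    by (simp add: l1_norm_def sum_product)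
  finally show ?thesis .
qed

lemma l1_norm_power:
  fixes F :: "'k::monoid_add \<Rightarrow>\<^sub>0 'a::real_normed_algebra_1"
  shows "l1_norm (F ^ n) \<le> l1_norm F ^ n"
proof (induction n)
  case 0
  show ?case by (simp add: l1_norm_def)
next
  case (Suc n)
  have "l1_norm (F ^ Suc n) \<le> l1_norm F * l1_norm (F ^ n)"
    by (simp add: l1_norm_mult)
  also have "\<dots> \<le> l1_norm F ^ Suc n"
    using Suc by (simp add: mult_left_mono l1_norm_nonneg)
  finally show ?case .
qed

lemma norm_coef_le_l1_norm: "norm (coef F x) \<le> l1_norm F"
proof (cases "x \<in> freqs F")
  case True
  then show ?thesis unfolding l1_norm_def by (intro member_le_sum) auto
qed (auto simp: in_keys_iff l1_norm_nonneg)

section \<open>The constant term as an expectation\<close>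

definition add_subgroup :: "'k::ab_group_add set \<Rightarrow> bool" where
  "add_subgroup A \<longleftrightarrow> 0 \<in> A \<and> (\<forall>x\<in>A. \<forall>y\<in>A. x - y \<in> A)"

lemma add_subgroup_0: "add_subgroup A \<Longrightarrow> 0 \<in> A"
  by (simp add: add_subgroup_def)

lemma add_subgroup_uminus: "add_subgroup A \<Longrightarrow> x \<in> A \<Longrightarrow> - x \<in> A"
  unfolding add_subgroup_def by (metis diff_0)

lemma add_subgroup_add: "add_subgroup A \<Longrightarrow> x \<in> A \<Longrightarrow> y \<in> A \<Longrightarrow> x + y \<in> A"
  using add_subgroup_uminus[of A y] unfolding add_subgroup_def by fastforce

lemma freqs_power_subgroup:
  fixes F :: "'k::ab_group_add \<Rightarrow>\<^sub>0 'a::semiring_1"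
  assumes "add_subgroup A" "freqs F \<subseteq> A"
  shows "freqs (F ^ k) \<subseteq> A"
  using assms by (intro freqs_power_subset) (auto intro: add_subgroup_0 add_subgroup_add)

lemma coef_0_mult_independent:
  fixes F G :: "'k::ab_group_add \<Rightarrow>\<^sub>0 'a::semiring_0"
  assumes F_in_A: "add_subgroup A" "freqs F \<subseteq> A" and G_in_B: "freqs G \<subseteq> B"
    and disjoint: "A \<inter> B \<subseteq> {0}"
  shows "coef (F * G) 0 = coef F 0 * coef G 0"
proof -
  have "coef (F * G) 0
      = (\<Sum>x\<in>freqs F. \<Sum>y\<in>freqs G. coef (wave (x + y) (coef F x * coef G y)) 0)"
    by (subst mult_eq_sum_wave) (simp only: lookup_sum)
  also have "\<dots> = (\<Sum>x\<in>freqs F. \<Sum>y\<in>freqs G.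
      (if x = 0 then coef F x else 0) * (if y = 0 then coef G y else 0))"
  proof (intro sum.cong refl)
    fix x y assume xy: "x \<in> freqs F" "y \<in> freqs G"
    have "y = 0" if "x + y = 0"
    proof -
      have "y = - x" using that by (simp add: eq_neg_iff_add_eq_0 add.commute)
      then have "y \<in> A" using add_subgroup_uminus[OF F_in_A(1)] F_in_A(2) xy by blast
      then show ?thesis using disjoint G_in_B xy by blast
    qed
    then show "coef (wave (x + y) (coef F x * coef G y)) 0
        = (if x = 0 then coef F x else 0) * (if y = 0 then coef G y else 0)"
      by (auto simp: lookup_single when_def)
  qed
  also have "\<dots> = (\<Sum>x\<in>freqs F. if x = 0 then coef F x else 0)
      * (\<Sum>y\<in>freqs G. if y = 0 then coef G y else 0)"
    by (simp only: sum_product)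
  also have "\<dots> = coef F 0 * coef G 0"
    by (auto simp: in_keys_iff)
  finally show ?thesis .
qed

definition moment_fps :: "('k::comm_monoid_add \<Rightarrow>\<^sub>0 'a::field_char_0) \<Rightarrow> 'a fps" where
  "moment_fps F = Abs_fps (\<lambda>n. coef (F ^ n) 0 / fact n)"

lemma moment_fps_0 [simp]: "moment_fps 0 = 1"
  by (rule fps_ext) (auto simp: moment_fps_def lookup_one power_0_left)

lemma moment_fps_add:
  fixes F G :: "'k::ab_group_add \<Rightarrow>\<^sub>0 'a::field_char_0"
  assumes F_in_A: "add_subgroup A" "freqs F \<subseteq> A"
    and G_in_B: "add_subgroup B" "freqs G \<subseteq> B"
    and disjoint: "A \<inter> B \<subseteq> {0}"
  shows "moment_fps (F + G) = moment_fps F * moment_fps G"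
proof (rule fps_ext)
  fix n
  have "coef ((F + G) ^ n) 0 = (\<Sum>k\<le>n. of_nat (n choose k) * coef (F ^ k * G ^ (n - k)) 0)"
    by (simp add: binomial_ring lookup_sum mult.assoc coef_of_nat_mult)
  also have "\<dots> = (\<Sum>k\<le>n. of_nat (n choose k) * (coef (F ^ k) 0 * coef (G ^ (n - k)) 0))"
    using coef_0_mult_independent[OF F_in_A(1) freqs_power_subgroup[OF F_in_A]
        freqs_power_subgroup[OF G_in_B] disjoint] by simp
  finally show "fps_nth (moment_fps (F + G)) n = fps_nth (moment_fps F * moment_fps G) n"
    by (auto simp: moment_fps_def fps_mult_nth binomial_fact sum_divide_distrib field_simps
             atLeast0AtMost intro!: sum.cong)
qed

definition log_fractions :: "nat set \<Rightarrow> real set" where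
  "log_fractions Q = {ln (real a) - ln (real b) |a b.
     a > 0 \<and> b > 0 \<and> prime_factors a \<subseteq> Q \<and> prime_factors b \<subseteq> Q}"

lemma log_fractions_mono: "Q \<subseteq> R \<Longrightarrow> log_fractions Q \<subseteq> log_fractions R"
  unfolding log_fractions_def by blast

lemma add_subgroup_log_fractions: "add_subgroup (log_fractions Q)"
  unfolding add_subgroup_def
proof (intro conjI ballI)
  show "0 \<in> log_fractions Q"
    unfolding log_fractions_def by (auto intro!: exI[of _ 1])
  fix x y assume "x \<in> log_fractions Q" "y \<in> log_fractions Q"
  then obtain a b c d where
    x_fraction: "x = ln (real a) - ln (real b)" "a > 0" "b > 0"
      "prime_factors a \<subseteq> Q" "prime_factors b \<subseteq> Q" and
    y_fraction: "y = ln (real c) - ln (real d)" "c > 0" "d > 0"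
      "prime_factors c \<subseteq> Q" "prime_factors d \<subseteq> Q"
    unfolding log_fractions_def by blast
  have "x - y = ln (real (a * d)) - ln (real (b * c))"
    using x_fraction y_fraction by (simp add: ln_mult)
  moreover have "prime_factors (a * d) \<subseteq> Q" "prime_factors (b * c) \<subseteq> Q"
    using x_fraction y_fraction by (simp_all add: prime_factors_product)
  ultimately show "x - y \<in> log_fractions Q"
    unfolding log_fractions_def using x_fraction y_fraction
    by (intro CollectI exI[of _ "a * d"] exI[of _ "b * c"]) auto
qed

lemma coprime_if_prime_factors_disjoint:
  fixes a b :: nat
  assumes "a > 0" "b > 0" "prime_factors a \<inter> prime_factors b = {}"
  shows "coprime a b"
proof (rule ccontr)
  assume "\<not> coprime a b"
  then obtain d where "d dvd a" "d dvd b" "d \<noteq> 1"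
    by (auto elim: not_coprimeE)
  then obtain p where "prime p" "p dvd a" "p dvd b"
    using prime_factor_nat[of d] by (meson dvd_trans)
  then show False
    using assms by (auto simp: in_prime_factors_iff)
qed

lemma log_fractions_disjoint:
  assumes "Q \<inter> R = {}"
  shows "log_fractions Q \<inter> log_fractions R \<subseteq> {0}"
proof
  fix x assume "x \<in> log_fractions Q \<inter> log_fractions R"
  then obtain a b c d where
    Q_fraction: "x = ln (real a) - ln (real b)" "a > 0" "b > 0"
      "prime_factors a \<subseteq> Q" "prime_factors b \<subseteq> Q" and
    R_fraction: "x = ln (real c) - ln (real d)" "c > 0" "d > 0"
      "prime_factors c \<subseteq> R" "prime_factors d \<subseteq> R"
    unfolding log_fractions_def by blast
  have "ln (real (a * d)) = ln (real (b * c))"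
    using Q_fraction R_fraction by (simp add: ln_mult)
  then have "real (a * d) = real (b * c)"
    using Q_fraction R_fraction by (subst (asm) ln_inj_iff) auto
  then have cross_eq: "a * d = b * c"
    by (simp only: of_nat_eq_iff)
  have "coprime a c" "coprime b d"
    using Q_fraction R_fraction assms by (auto intro!: coprime_if_prime_factors_disjoint)
  then have "a dvd b" "b dvd a"
    using cross_eq by (metis coprime_dvd_mult_left_iff dvd_triv_left)+
  then show "x \<in> {0}"
    using Q_fraction by (simp add: dvd_antisym)
qed

lemma ln_prime_power_in_log_fractions:
  assumes "prime p"
  shows "ln (real (p ^ k)) \<in> log_fractions {p}"
  unfolding log_fractions_def using assms prime_gt_0_nat[OF assms]
  by (intro CollectI exI[of _ "p ^ k"] exI[of _ 1])
     (auto simp: prime_factorization_prime_power split: if_splits)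

lemma moment_fps_sum:
  assumes "finite P" "\<And>p. p \<in> P \<Longrightarrow> freqs (F p) \<subseteq> log_fractions {p}"
  shows "moment_fps (\<Sum>p\<in>P. F p) = (\<Prod>p\<in>P. moment_fps (F p))"
  using assms
proof (induction P rule: finite_induct)
  case (insert p P)
  have "freqs (\<Sum>q\<in>P. F q) \<subseteq> (\<Union>q\<in>P. freqs (F q))"
    by (rule keys_sum)
  also have "\<dots> \<subseteq> log_fractions P"
    using insert.prems log_fractions_mono[of "{_}" P] by fastforce
  finally have "moment_fps (F p + (\<Sum>q\<in>P. F q)) = moment_fps (F p) * moment_fps (\<Sum>q\<in>P. F q)"
    using insert.hyps insert.prems
    by (intro moment_fps_add[where A = "log_fractions {p}" and B = "log_fractions P"]
        add_subgroup_log_fractions log_fractions_disjoint) auto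
  then show ?case using insert by simp
qed simp

section \<open>Products of power series close to Gaussian ones\<close>

definition fps_trunc_norm :: "nat \<Rightarrow> 'a::real_normed_vector fps \<Rightarrow> real" where
  "fps_trunc_norm m F = (\<Sum>i\<le>m. norm (fps_nth F i))"

lemma fps_trunc_norm_nonneg: "fps_trunc_norm m F \<ge> 0"
  by (simp add: fps_trunc_norm_def sum_nonneg)

lemma fps_trunc_norm_0 [simp]: "fps_trunc_norm m 0 = 0"
  by (simp add: fps_trunc_norm_def)

lemma fps_trunc_norm_1 [simp]: "fps_trunc_norm m (1 :: 'a::real_normed_algebra_1 fps) = 1"
proof -
  have "fps_trunc_norm m (1 :: 'a fps) = (\<Sum>i\<le>m. if i = 0 then 1 else 0)"
    unfolding fps_trunc_norm_def by (intro sum.cong) auto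
  then show ?thesis by simp
qed

lemma norm_fps_nth_le_trunc_norm: "norm (fps_nth F m) \<le> fps_trunc_norm m F"
  unfolding fps_trunc_norm_def by (rule member_le_sum) auto

lemma fps_trunc_norm_add: "fps_trunc_norm m (F + G) \<le> fps_trunc_norm m F + fps_trunc_norm m G"
  unfolding fps_trunc_norm_def sum.distrib[symmetric]
  by (intro sum_mono) (simp add: norm_triangle_ineq)

lemma fps_trunc_norm_mult:
  fixes F G :: "'a::real_normed_algebra_1 fps"
  shows "fps_trunc_norm m (F * G) \<le> fps_trunc_norm m F * fps_trunc_norm m G"
proof -
  let ?h = "\<lambda>i j. norm (fps_nth F i) * norm (fps_nth G j)"
  have "fps_trunc_norm m (F * G) \<le> (\<Sum>k\<le>m. \<Sum>i\<le>k. ?h i (k - i))"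
    unfolding fps_trunc_norm_def fps_mult_nth atLeast0AtMost
    by (intro sum_mono order_trans[OF norm_sum]) (rule norm_mult_ineq)
  also have "\<dots> = (\<Sum>(i, j)\<in>{(i, j). i + j \<le> m}. ?h i j)"
    by (rule sum.triangle_reindex_eq[symmetric])
  also have "\<dots> \<le> (\<Sum>(i, j)\<in>{..m} \<times> {..m}. ?h i j)"
    by (intro sum_mono2) auto
  also have "\<dots> = fps_trunc_norm m F * fps_trunc_norm m G"
    unfolding fps_trunc_norm_def sum_product sum.cartesian_product ..
  finally show ?thesis .
qed

lemma fps_trunc_norm_le_exp:
  fixes F :: "'a::real_normed_algebra_1 fps"
  assumes "fps_trunc_norm m (F - 1) \<le> r"
  shows "fps_trunc_norm m F \<le> exp r"
proof -
  have "fps_trunc_norm m F \<le> 1 + fps_trunc_norm m (F - 1)"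
    using fps_trunc_norm_add[of m 1 "F - 1"] by simp
  also have "\<dots> \<le> 1 + r" using assms by simp
  also have "\<dots> \<le> exp r" by simp
  finally show ?thesis .
qed

lemma fps_trunc_norm_prod_le_exp:
  fixes F :: "'i \<Rightarrow> 'a::real_normed_field fps"
  assumes "\<And>i. i \<in> I \<Longrightarrow> fps_trunc_norm m (F i - 1) \<le> r i"
  shows "fps_trunc_norm m (\<Prod>i\<in>I. F i) \<le> exp (\<Sum>i\<in>I. r i)"
  using assms
proof (induction I rule: infinite_finite_induct)
  case (insert i I)
  have "fps_trunc_norm m (F i * prod F I) \<le> fps_trunc_norm m (F i) * fps_trunc_norm m (prod F I)"
    by (rule fps_trunc_norm_mult)
  also have "\<dots> \<le> exp (r i) * exp (\<Sum>i\<in>I. r i)"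
    using insert fps_trunc_norm_le_exp[of m "F i" "r i"]
    by (intro mult_mono fps_trunc_norm_nonneg) auto
  finally show ?case using insert.hyps by (simp add: exp_add)
qed auto

lemma fps_trunc_norm_prod_diff_le:
  fixes F G :: "'i \<Rightarrow> 'a::real_normed_field fps"
  assumes "\<And>i. i \<in> I \<Longrightarrow> fps_trunc_norm m (F i - 1) \<le> r i"
    and "\<And>i. i \<in> I \<Longrightarrow> fps_trunc_norm m (G i - 1) \<le> r i"
  shows "fps_trunc_norm m ((\<Prod>i\<in>I. F i) - (\<Prod>i\<in>I. G i))
    \<le> (\<Sum>i\<in>I. fps_trunc_norm m (F i - G i)) * exp (\<Sum>i\<in>I. r i)"
  using assms
proof (induction I rule: infinite_finite_induct)
  case (insert i I)
  let ?N = "fps_trunc_norm m" and ?D = "\<Sum>i\<in>I. fps_trunc_norm m (F i - G i)"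
    and ?R = "\<Sum>i\<in>I. r i"
  have r_nonneg: "r i \<ge> 0"
    using insert.prems(1)[of i] fps_trunc_norm_nonneg[of m "F i - 1"] by simp
  have "prod F (insert i I) - prod G (insert i I)
      = (F i - G i) * prod F I + G i * (prod F I - prod G I)"
    using insert.hyps by (simp add: algebra_simps)
  then have "?N (prod F (insert i I) - prod G (insert i I))
      \<le> ?N ((F i - G i) * prod F I) + ?N (G i * (prod F I - prod G I))"
    by (simp only: fps_trunc_norm_add)
  also have "\<dots> \<le> ?N (F i - G i) * ?N (prod F I) + ?N (G i) * ?N (prod F I - prod G I)"
    by (intro add_mono fps_trunc_norm_mult)
  also have "\<dots> \<le> ?N (F i - G i) * exp ?R + exp (r i) * (?D * exp ?R)"
    using insert by (intro add_mono mult_mono fps_trunc_norm_prod_le_exp fps_trunc_norm_le_exp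
        fps_trunc_norm_nonneg) auto
  also have "\<dots> \<le> ?N (F i - G i) * exp (r i + ?R) + ?D * exp (r i + ?R)"
    using r_nonneg
    by (intro add_mono mult_left_mono fps_trunc_norm_nonneg) (auto simp: exp_add)
  also have "\<dots> = (\<Sum>i\<in>insert i I. ?N (F i - G i)) * exp (\<Sum>i\<in>insert i I. r i)"
    using insert.hyps by (simp add: ring_distribs)
  finally show ?case .
qed auto

lemma fps_trunc_norm_le_power:
  assumes "0 \<le> q" "q \<le> Q" "b \<ge> 0"
    and low: "\<And>s. s < r \<Longrightarrow> fps_nth F s = 0"
    and high: "\<And>s. r \<le> s \<Longrightarrow> norm (fps_nth F s) \<le> b * q ^ s"
  shows "fps_trunc_norm m F \<le> real (m + 1) * (b * ((1 + Q) ^ m * q ^ r))"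
proof -
  have "norm (fps_nth F s) \<le> b * ((1 + Q) ^ m * q ^ r)" if "s \<le> m" for s
  proof (cases "r \<le> s")
    case True
    have "q ^ (s - r) \<le> (1 + Q) ^ (s - r)" using assms by (intro power_mono) auto
    also have "\<dots> \<le> (1 + Q) ^ m" using assms that by (intro power_increasing) auto
    finally have "q ^ (s - r) * q ^ r \<le> (1 + Q) ^ m * q ^ r"
      using assms by (intro mult_right_mono) auto
    then have "q ^ s \<le> (1 + Q) ^ m * q ^ r"
      using True by (simp flip: power_add)
    then show ?thesis
      using high[OF True] assms(3) by (meson mult_left_mono order_trans)
  next
    case False
    then show ?thesis using low[of s] assms by simp
  qed
  then have "fps_trunc_norm m F \<le> (\<Sum>s\<le>m. b * ((1 + Q) ^ m * q ^ r))"
    unfolding fps_trunc_norm_def by (intro sum_mono) auto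
  then show ?thesis by simp
qed

definition gauss_fps :: "'a::field_char_0 \<Rightarrow> 'a fps" where
  "gauss_fps v = Abs_fps (\<lambda>n. if even n then (v / 2) ^ (n div 2) / fact (n div 2) else 0)"

lemma gauss_fps_eq_exp_compose: "gauss_fps v = fps_exp (v / 2) oo fps_X ^ 2"
proof (rule fps_ext)
  fix n
  have "fps_nth (fps_exp (v / 2) oo fps_X ^ 2) n
      = (\<Sum>i=0..n. if n = 2 * i then (v / 2) ^ i / fact i else 0)"
    by (auto simp: fps_compose_nth simp flip: power_mult intro!: sum.cong)
  also have "\<dots> = fps_nth (gauss_fps v) n"
  proof (cases "even n")
    case True
    then have "(\<Sum>i=0..n. if n = 2 * i then (v / 2) ^ i / fact i else 0)
        = (\<Sum>i=0..n. if i = n div 2 then (v / 2) ^ i / fact i else 0)"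
      by (intro sum.cong) auto
    then show ?thesis using True by (simp add: gauss_fps_def)
  next
    case False
    then have "\<And>i. n \<noteq> 2 * i" by auto
    then show ?thesis using False by (simp add: gauss_fps_def)
  qed
  finally show "fps_nth (gauss_fps v) n = fps_nth (fps_exp (v / 2) oo fps_X ^ 2) n" by simp
qed

lemma gauss_fps_add: "gauss_fps (v + w) = gauss_fps v * gauss_fps w"
  unfolding gauss_fps_eq_exp_compose
  by (subst fps_compose_mult_distrib[symmetric])
     (auto simp: add_divide_distrib simp flip: fps_exp_add_mult)

lemma gauss_fps_sum: "finite I \<Longrightarrow> gauss_fps (\<Sum>i\<in>I. v i) = (\<Prod>i\<in>I. gauss_fps (v i))"
proof (induction I rule: finite_induct)
  case empty
  show ?case by (simp add: gauss_fps_eq_exp_compose)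
qed (auto simp: gauss_fps_add)

lemma fact_mult_gauss_fps_nth:
  fixes v :: "'a::real_normed_field"
  shows "fact m * fps_nth (gauss_fps v) m
    = (if even m then of_real (fact m / (fact (m div 2) * 2 ^ (m div 2))) * v ^ (m div 2) else 0)"
  by (simp add: gauss_fps_def power_divide)

lemma power_diff_bigo:
  fixes f g :: "'a \<Rightarrow> 'b::real_normed_field"
  assumes diff: "(\<lambda>x. f x - z) \<in> O[F](g)" and g: "g \<in> O[F](\<lambda>_. 1)"
  shows "(\<lambda>x. f x ^ k - z ^ k) \<in> O[F](g)"
proof (induction k)
  case (Suc k)
  have "f \<in> O[F](\<lambda>_. 1)"
    using sum_in_bigo(1)[OF landau_o.big_trans[OF diff g] bigo_const[of z]] by simp
  then have "(\<lambda>x. f x ^ k) \<in> O[F](\<lambda>_. 1)"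
    using landau_o.big_power[of f F "\<lambda>_. 1" k] by simp
  then have "(\<lambda>x. f x ^ k * (f x - z) + z * (f x ^ k - z ^ k)) \<in> O[F](g)"
    using Suc.IH diff landau_o.big_mult[of "\<lambda>x. f x ^ k" F "\<lambda>_. 1" "\<lambda>x. f x - z" g]
    by (intro sum_in_bigo) auto
  then show ?case by (simp add: algebra_simps)
qed simp

lemma gauss_fps_nth_diff_bigo:
  fixes v :: "'a \<Rightarrow> 'b::real_normed_field"
  assumes "(\<lambda>x. v x - z) \<in> O[F](g)" "g \<in> O[F](\<lambda>_. 1)"
  shows "(\<lambda>x. fps_nth (gauss_fps (v x)) m - fps_nth (gauss_fps z) m) \<in> O[F](g)"
proof (cases "even m")
  case True
  have "(\<lambda>x. (v x ^ (m div 2) - z ^ (m div 2)) / (2 ^ (m div 2) * fact (m div 2))) \<in> O[F](g)"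
    using power_diff_bigo[OF assms] by simp
  then show ?thesis
    using True by (simp add: gauss_fps_def power_divide diff_divide_distrib)
qed (simp add: gauss_fps_def)

definition centred_fps :: "real \<Rightarrow> 'a::real_normed_field fps \<Rightarrow> bool" where
  "centred_fps q F \<longleftrightarrow>
     fps_nth F 0 = 1 \<and> fps_nth F 1 = 0 \<and> (\<forall>s. norm (fps_nth F s) \<le> q ^ s)"

lemma centred_fps_imp_nonneg: "centred_fps q F \<Longrightarrow> q \<ge> 0"
  unfolding centred_fps_def by (metis norm_zero power_one_right)

lemma centred_fps_moment_fps:
  fixes F :: "'k::comm_monoid_add \<Rightarrow>\<^sub>0 'a::real_normed_field"
  assumes "coef F 0 = 0" "l1_norm F \<le> q"
  shows "centred_fps q (moment_fps F)"
  unfolding centred_fps_def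
proof (intro conjI allI)
  fix s
  have "norm (fps_nth (moment_fps F) s) = norm (coef (F ^ s) 0) / fact s"
    by (simp add: moment_fps_def norm_divide)
  also have "\<dots> \<le> norm (coef (F ^ s) 0) / 1"
    by (intro divide_left_mono) auto
  also have "\<dots> \<le> l1_norm F ^ s"
    using norm_coef_le_l1_norm[of "F ^ s" 0] l1_norm_power[of F s] by simp
  also have "\<dots> \<le> q ^ s"
    by (intro power_mono assms l1_norm_nonneg)
  finally show "norm (fps_nth (moment_fps F) s) \<le> q ^ s" .
qed (use assms in \<open>simp_all add: moment_fps_def\<close>)

lemma centred_fps_gauss_fps:
  assumes "centred_fps q F"
  shows "centred_fps q (gauss_fps (2 * fps_nth F 2))"
  unfolding centred_fps_def
proof (intro conjI allI)
  fix s
  show "norm (fps_nth (gauss_fps (2 * fps_nth F 2)) s) \<le> q ^ s"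
  proof (cases "even s")
    case True
    then obtain k where s_eq: "s = 2 * k" by auto
    have "norm (fps_nth (gauss_fps (2 * fps_nth F 2)) s) = norm (fps_nth F 2) ^ k / fact k"
      by (simp add: gauss_fps_def s_eq norm_divide norm_power)
    also have "\<dots> \<le> norm (fps_nth F 2) ^ k / 1"
      by (intro divide_left_mono) auto
    also have "\<dots> \<le> (q ^ 2) ^ k"
      using assms by (auto simp: centred_fps_def intro: power_mono)
    finally show ?thesis by (simp add: s_eq power_mult)
  qed (use centred_fps_imp_nonneg[OF assms] in \<open>simp add: gauss_fps_def\<close>)
qed (simp_all add: gauss_fps_def)

lemma fps_trunc_norm_centred_minus_1_le:
  assumes "centred_fps q F" "q \<le> Q"
  shows "fps_trunc_norm m (F - 1) \<le> real (m + 1) * (1 + Q) ^ m * q ^ 2"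
proof -
  have "fps_trunc_norm m (F - 1) \<le> real (m + 1) * (1 * ((1 + Q) ^ m * q ^ 2))"
    using assms centred_fps_imp_nonneg[OF assms(1)]
    by (intro fps_trunc_norm_le_power) (auto simp: centred_fps_def less_2_cases_iff)
  then show ?thesis by (simp add: mult_ac)
qed

lemma fps_trunc_norm_diff_gauss_le:
  assumes "centred_fps q F" "q \<le> Q"
  shows "fps_trunc_norm m (F - gauss_fps (2 * fps_nth F 2))
    \<le> 2 * (real (m + 1) * (1 + Q) ^ m * q ^ 3)"
proof -
  let ?G = "gauss_fps (2 * fps_nth F 2)"
  have F_centred: "fps_nth F 0 = 1" "fps_nth F 1 = 0" "norm (fps_nth F s) \<le> q ^ s"
    and gauss_bound: "norm (fps_nth ?G s) \<le> q ^ s" for s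
    using assms centred_fps_gauss_fps[OF assms(1)] unfolding centred_fps_def by auto
  have "fps_trunc_norm m (F - ?G) \<le> real (m + 1) * (2 * ((1 + Q) ^ m * q ^ 3))"
  proof (rule fps_trunc_norm_le_power)
    fix s :: nat assume "s < 3"
    then consider "s = 0" | "s = 1" | "s = 2" by linarith
    then show "fps_nth (F - ?G) s = 0"
      by cases (use F_centred(1,2) in \<open>auto simp: gauss_fps_def\<close>)
  next
    fix s
    show "norm (fps_nth (F - ?G) s) \<le> 2 * q ^ s"
      using norm_triangle_ineq4[of "fps_nth F s" "fps_nth ?G s"] F_centred(3)[of s] gauss_bound[of s]
      by simp
  qed (use assms centred_fps_imp_nonneg in auto)
  then show ?thesis by (simp add: mult_ac)
qed

lemma prod_centred_fps_near_gauss: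
  fixes F :: "'i \<Rightarrow> 'a::real_normed_field fps" and Q :: real and m :: nat
  assumes "finite I"
    and centred: "\<And>i. i \<in> I \<Longrightarrow> centred_fps (q i) (F i)" "\<And>i. i \<in> I \<Longrightarrow> q i \<le> Q"
  defines "K \<equiv> real (m + 1) * (1 + Q) ^ m"
  shows "norm (fps_nth (\<Prod>i\<in>I. F i) m - fps_nth (gauss_fps (\<Sum>i\<in>I. 2 * fps_nth (F i) 2)) m)
       \<le> 2 * K * (\<Sum>i\<in>I. q i ^ 3) * exp (K * (\<Sum>i\<in>I. q i ^ 2))"
proof -
  define G where "G i = gauss_fps (2 * fps_nth (F i) 2)" for i
  have "norm (fps_nth (\<Prod>i\<in>I. F i) m - fps_nth (gauss_fps (\<Sum>i\<in>I. 2 * fps_nth (F i) 2)) m)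
      = norm (fps_nth ((\<Prod>i\<in>I. F i) - (\<Prod>i\<in>I. G i)) m)"
    using assms(1) by (simp add: gauss_fps_sum G_def)
  also have "\<dots> \<le> fps_trunc_norm m ((\<Prod>i\<in>I. F i) - (\<Prod>i\<in>I. G i))"
    by (rule norm_fps_nth_le_trunc_norm)
  also have "\<dots> \<le> (\<Sum>i\<in>I. fps_trunc_norm m (F i - G i)) * exp (\<Sum>i\<in>I. K * q i ^ 2)"
    unfolding K_def G_def using centred
    by (intro fps_trunc_norm_prod_diff_le fps_trunc_norm_centred_minus_1_le centred_fps_gauss_fps)
  also have "\<dots> \<le> (\<Sum>i\<in>I. 2 * (K * q i ^ 3)) * exp (\<Sum>i\<in>I. K * q i ^ 2)"
    unfolding K_def G_def using centred
    by (intro mult_right_mono sum_mono fps_trunc_norm_diff_gauss_le) auto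
  finally show ?thesis by (simp add: sum_distrib_left mult.assoc)
qed

section \<open>Mertens' first theorem\<close>

lemma sum_over_prime_powers:
  fixes h :: "nat \<Rightarrow> 'a :: comm_monoid_add"
  assumes non_primepow: "\<And>n. \<not> primepow n \<Longrightarrow> h n = 0" and large: "\<And>n. n > N \<Longrightarrow> h n = 0"
  shows "(\<Sum>n\<le>N. h n) = (\<Sum>p | prime p \<and> p \<le> N. \<Sum>k=1..N. h (p ^ k))"
proof -
  let ?P = "{p. prime p \<and> p \<le> N}"
  let ?A = "{(p, k). prime p \<and> p \<le> N \<and> k \<in> {1..N} \<and> p ^ k \<le> N}"
  have "(\<Sum>p\<in>?P. \<Sum>k=1..N. h (p ^ k)) = (\<Sum>(p, k)\<in>?P \<times> {1..N}. h (p ^ k))"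
    by (simp add: sum.cartesian_product)
  also have "\<dots> = (\<Sum>(p, k)\<in>?A. h (p ^ k))"
    by (intro sum.mono_neutral_right) (auto intro: large simp: not_le)
  also have "\<dots> = (\<Sum>n\<in>(\<lambda>(p, k). p ^ k) ` ?A. h n)"
    by (subst sum.reindex) (auto simp: inj_on_def prime_power_inj'' case_prod_unfold)
  also have "(\<lambda>(p, k). p ^ k) ` ?A = {n. n \<le> N \<and> primepow n}"
  proof (intro equalityI subsetI)
    fix n assume "n \<in> {n. n \<le> N \<and> primepow n}"
    then obtain p k where prime_power: "prime p" "k > 0" "n = p ^ k" "n \<le> N"
      by (auto simp: primepow_def)
    have "p \<ge> 2" using prime_power prime_ge_2_nat by blast
    have "k < 2 ^ k" by simp
    also have "(2::nat) ^ k \<le> p ^ k" using \<open>p \<ge> 2\<close> by (rule power_mono) auto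
    finally have "k \<le> N" using prime_power by simp
    moreover have "p \<le> N"
      using self_le_power[of p k] prime_power \<open>p \<ge> 2\<close> by simp
    ultimately show "n \<in> (\<lambda>(p, k). p ^ k) ` ?A" using prime_power by force
  qed auto
  also have "(\<Sum>n | n \<le> N \<and> primepow n. h n) = (\<Sum>n\<le>N. h n)"
    by (intro sum.mono_neutral_left) (auto intro: non_primepow)
  finally show ?thesis by simp
qed

lemma ln_fact_eq_sum_mangoldt: "ln (fact N :: real) = (\<Sum>d=1..N. mangoldt d * real (N div d))"
proof (induction N)
  case 0
  show ?case by simp
next
  case (Suc N)
  have "(\<Sum>d=1..Suc N. mangoldt d * real (Suc N div d))
      = (\<Sum>d=1..Suc N. mangoldt d * real (N div d) + (if d dvd Suc N then mangoldt d else 0))"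
    by (intro sum.cong refl) (auto simp: div_Suc dvd_eq_mod_eq_0 ring_distribs)
  also have "\<dots> = (\<Sum>d=1..N. mangoldt d * real (N div d))
      + (\<Sum>d\<in>{1..Suc N} \<inter> {d. d dvd Suc N}. mangoldt d)"
    by (simp add: sum.distrib sum.inter_restrict)
  also have "{1..Suc N} \<inter> {d. d dvd Suc N} = {d. d dvd Suc N}"
    by (auto dest: dvd_imp_le intro!: Nat.gr0I simp: Suc_le_eq)
  also have "(\<Sum>d | d dvd Suc N. mangoldt d :: real) = ln (real (Suc N))"
    using mangoldt_sum[of "Suc N", where ?'a = real] by simp
  finally show ?case using Suc by (simp add: ln_mult)
qed

definition chebyshev_psi :: "nat \<Rightarrow> real" where
  "chebyshev_psi N = (\<Sum>d=1..N. mangoldt d)"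

lemma ln_central_binomial_eq_sum_mangoldt:
  "ln (real (2 * n choose n)) = (\<Sum>d=1..2*n. mangoldt d * (real (2 * n div d) - 2 * real (n div d)))"
proof -
  have "real (2 * n choose n) = fact (2 * n) / (fact n * fact n)"
    using binomial_fact[of n "2 * n", where ?'a = real] by simp
  then have "ln (real (2 * n choose n)) = ln (fact (2 * n)) - 2 * ln (fact n)"
    by (simp add: ln_div ln_mult)
  also have "\<dots> = (\<Sum>d=1..2*n. mangoldt d * real (2 * n div d))
      - 2 * (\<Sum>d=1..n. mangoldt d * real (n div d))"
    by (simp only: ln_fact_eq_sum_mangoldt)
  also have "(\<Sum>d=1..n. mangoldt d * real (n div d)) = (\<Sum>d=1..2*n. mangoldt d * real (n div d))"
    by (intro sum.mono_neutral_left) auto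
  finally show ?thesis
    by (simp add: sum_subtractf sum_distrib_left algebra_simps)
qed

lemma chebyshev_psi_dyadic: "chebyshev_psi (2 * n) - chebyshev_psi n \<le> 2 * real n * ln 2"
proof -
  let ?r = "\<lambda>d. real (2 * n div d) - 2 * real (n div d)"
  have "{1..2*n} = {1..n} \<union> {n+1..2*n}" by auto
  then have "chebyshev_psi (2 * n) - chebyshev_psi n = (\<Sum>d=n+1..2*n. mangoldt d)"
    unfolding chebyshev_psi_def by (subst \<open>{1..2*n} = _\<close>, subst sum.union_disjoint) auto
  also have "\<dots> = (\<Sum>d=n+1..2*n. mangoldt d * ?r d)"
  proof (intro sum.cong refl)
    fix d assume d: "d \<in> {n+1..2*n}"
    then have "2 * n div d = 1" by (intro div_nat_eqI) auto
    then show "mangoldt d = mangoldt d * ?r d" using d by simp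
  qed
  also have "\<dots> \<le> (\<Sum>d=1..2*n. mangoldt d * ?r d)"
  proof (intro sum_mono2 mult_nonneg_nonneg mangoldt_nonneg)
    fix d
    have "2 * (n div d) \<le> 2 * n div d"
      by (cases "d = 0") (auto simp: less_eq_div_iff_mult_less_eq)
    then have "real (2 * (n div d)) \<le> real (2 * n div d)" by (rule of_nat_mono)
    then show "0 \<le> ?r d" by simp
  qed auto
  also have "\<dots> = ln (real (2 * n choose n))"
    by (rule ln_central_binomial_eq_sum_mangoldt[symmetric])
  also have "\<dots> \<le> ln (real (2 ^ (2 * n)))"
    by (subst ln_le_cancel_iff) (auto simp del: of_nat_power intro!: binomial_le_pow2)
  also have "\<dots> = 2 * real n * ln 2" by (simp add: ln_realpow)
  finally show ?thesis .
qed

lemma chebyshev_psi_le: "chebyshev_psi N \<le> 6 * real N"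
proof (induction N rule: less_induct)
  case (less N)
  show ?case
  proof (cases "N \<ge> 2")
    case False
    then have "N = 0 \<or> N = 1" by auto
    then show ?thesis by (auto simp: chebyshev_psi_def)
  next
    case True
    define n where "n = (N + 1) div 2"
    have half: "n < N" "N \<le> 2 * n" "2 * n \<le> N + 1" using True by (auto simp: n_def)
    have "chebyshev_psi N \<le> chebyshev_psi (2 * n)"
      unfolding chebyshev_psi_def using half by (intro sum_mono2 mangoldt_nonneg) auto
    also have "\<dots> \<le> 6 * real n + 2 * real n * ln 2"
      using less[OF half(1)] chebyshev_psi_dyadic[of n] by linarith
    also have "\<dots> \<le> 6 * real n + 2 * real n * 1"
      using ln_2_less_1 by (intro add_mono mult_left_mono) auto
    also have "\<dots> \<le> 6 * real N" using half True by linarith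
    finally show ?thesis .
  qed
qed

lemma ln_fact_le: "ln (fact N :: real) \<le> real N * ln (real N)"
proof (cases "N = 0")
  case False
  have "(fact N :: real) \<le> real N ^ N" using fact_le_power[of N, where ?'a = real] by simp
  then have "ln (fact N :: real) \<le> ln (real N ^ N)"
    using False by (subst ln_le_cancel_iff) auto
  then show ?thesis using False by (simp add: ln_realpow)
qed simp

lemma ln_fact_ge: "ln (fact N :: real) \<ge> real N * ln (real N) - real N"
proof (cases "N = 0")
  case False
  have "real N ^ N / fact N = (\<Sum>n\<in>{N}. real N ^ n /\<^sub>R fact n)" by (simp add: field_simps)
  also have "\<dots> \<le> suminf (\<lambda>n. real N ^ n /\<^sub>R fact n)"
    by (intro sum_le_suminf summable_exp_generic) auto
  also have "\<dots> = exp (real N)" by (simp add: exp_def)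
  finally have "ln (real N ^ N / fact N) \<le> ln (exp (real N))"
    using False by (subst ln_le_cancel_iff) auto
  then show ?thesis using False by (simp add: ln_div ln_realpow)
qed simp

lemma sum_mangoldt_over_le:
  assumes "N > 0"
  shows "(\<Sum>d=1..N. mangoldt d / real d) \<le> ln (real N) + 6"
proof -
  have "real N * (\<Sum>d=1..N. mangoldt d / real d) = (\<Sum>d=1..N. mangoldt d * (real N / real d))"
    by (simp add: sum_distrib_left mult_ac)
  also have "\<dots> \<le> (\<Sum>d=1..N. mangoldt d * (real (N div d) + 1))"
  proof (intro sum_mono mult_left_mono mangoldt_nonneg)
    fix d assume d: "d \<in> {1..N}"
    have "N \<le> d * (N div d + 1)" using d dividend_less_times_div[of d N] by simp
    then have "real N \<le> real (d * (N div d + 1))" by (simp only: of_nat_le_iff)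
    then show "real N / real d \<le> real (N div d) + 1"
      using d by (simp add: field_simps)
  qed
  also have "\<dots> = ln (fact N) + chebyshev_psi N"
    by (simp add: ln_fact_eq_sum_mangoldt chebyshev_psi_def ring_distribs sum.distrib)
  also have "\<dots> \<le> real N * ln (real N) + 6 * real N"
    by (intro add_mono chebyshev_psi_le ln_fact_le)
  also have "\<dots> = real N * (ln (real N) + 6)" by (simp add: algebra_simps)
  finally show ?thesis using assms by (simp add: mult_le_cancel_left_pos)
qed

lemma sum_mangoldt_over_ge:
  assumes "N > 0"
  shows "(\<Sum>d=1..N. mangoldt d / real d) \<ge> ln (real N) - 1"
proof -
  have "real N * (ln (real N) - 1) \<le> ln (fact N)"
    using ln_fact_ge[of N] by (simp add: algebra_simps)
  also have "\<dots> \<le> (\<Sum>d=1..N. mangoldt d * (real N / real d))"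
    unfolding ln_fact_eq_sum_mangoldt
    by (intro sum_mono mult_left_mono mangoldt_nonneg of_nat_div_le_of_nat)
  also have "\<dots> = real N * (\<Sum>d=1..N. mangoldt d / real d)"
    by (simp add: sum_distrib_left mult_ac)
  finally show ?thesis using assms by (simp add: mult_le_cancel_left_pos)
qed

definition ln_power_series :: "nat \<Rightarrow> real" where
  "ln_power_series s = suminf (\<lambda>n. ln (real n) ^ s / (real n * sqrt (real n)))"

lemma sum_ln_power_over_le:
  assumes "finite A"
  shows "(\<Sum>n\<in>A. ln (real n) ^ s / (real n * sqrt (real n))) \<le> ln_power_series s"
  unfolding ln_power_series_def
proof (intro sum_le_suminf assms)
  show "summable (\<lambda>n. ln (real n) ^ s / (real n * sqrt (real n)))"
  proof (rule summable_comparison_test_bigo)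
    show "summable (\<lambda>n. norm (real n powr (-5/4)))"
      by (simp add: summable_real_powr_iff)
    show "(\<lambda>n. ln (real n) ^ s / (real n * sqrt (real n))) \<in> O(\<lambda>n. real n powr (-5/4))"
      by real_asymp
  qed
next
  fix n :: nat
  have "ln (real n) \<ge> 0" by (cases "n = 0") auto
  then show "0 \<le> ln (real n) ^ s / (real n * sqrt (real n))" by simp
qed

lemma ln_power_series_nonneg: "ln_power_series s \<ge> 0"
  using sum_ln_power_over_le[of "{}" s] by simp

lemma sum_geometric_tail_le:
  fixes x :: real
  assumes "0 \<le> x" "x < 1"
  shows "(\<Sum>k=j..N. x ^ k) \<le> x ^ j / (1 - x)"
proof (cases "j \<le> N")
  case True
  have "(1 - x) * (\<Sum>k=j..N. x ^ k) = x ^ j - x ^ Suc N"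
    by (rule sum_gp_multiplied[OF True])
  also have "\<dots> \<le> x ^ j" using assms by simp
  finally show ?thesis using assms by (simp add: field_simps)
qed (use assms in simp)

lemma sum_higher_powers_le:
  fixes x :: real
  assumes "x \<ge> 2"
  shows "(\<Sum>k=2..N. (1 / x) ^ k) \<le> 2 / (x * sqrt x)"
proof -
  have "(\<Sum>k=2..N. (1 / x) ^ k) \<le> (1 / x) ^ 2 / (1 - 1 / x)"
    using assms by (intro sum_geometric_tail_le) auto
  also have "\<dots> \<le> (1 / x) ^ 2 / (1 / 2)"
    using assms by (intro divide_left_mono) (auto simp: field_simps)
  also have "\<dots> = 2 / (x * x)" by (simp add: power2_eq_square)
  also have "\<dots> \<le> 2 / (x * sqrt x)"
  proof (intro divide_left_mono mult_left_mono)
    show "sqrt x \<le> x" using assms by (intro real_le_lsqrt) (auto simp: power2_eq_square)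
  qed (use assms in auto)
  finally show ?thesis .
qed

lemma sum_primes_over_le_sum_mangoldt_over:
  "(\<Sum>p | prime p \<and> p \<le> N. ln (real p) / real p) \<le> (\<Sum>d=1..N. mangoldt d / real d)"
proof -
  have "(\<Sum>p | prime p \<and> p \<le> N. ln (real p) / real p)
      = (\<Sum>p | prime p \<and> p \<le> N. mangoldt p / real p)"
    by (intro sum.cong) auto
  also have "\<dots> \<le> (\<Sum>d=1..N. mangoldt d / real d)"
    by (intro sum_mono2) (auto simp: mangoldt_nonneg Suc_le_eq prime_gt_0_nat)
  finally show ?thesis .
qed

lemma sum_mangoldt_over_le_sum_primes_over:
  "(\<Sum>d=1..N. mangoldt d / real d)
    \<le> (\<Sum>p | prime p \<and> p \<le> N. ln (real p) / real p) + 2 * ln_power_series 1"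
proof (cases "N = 0")
  case False
  let ?P = "{p. prime p \<and> p \<le> N}"
  define h where "h n = (if n \<le> N then mangoldt n / real n else 0)" for n
  have "(\<Sum>d=1..N. mangoldt d / real d) = (\<Sum>n\<le>N. h n)"
    by (intro sum.mono_neutral_cong_left) (auto simp: h_def not_le)
  also have "\<dots> = (\<Sum>p\<in>?P. \<Sum>k=1..N. h (p ^ k))"
    by (rule sum_over_prime_powers) (auto simp: h_def mangoldt_def)
  also have "\<dots> \<le> (\<Sum>p\<in>?P. ln (real p) / real p + 2 * (ln (real p) ^ 1 / (real p * sqrt (real p))))"
  proof (intro sum_mono)
    fix p assume "p \<in> ?P"
    then have p: "prime p" "p \<ge> 2" using prime_ge_2_nat by auto
    have "(\<Sum>k=1..N. h (p ^ k)) \<le> (\<Sum>k=1..N. ln (real p) * (1 / real p) ^ k)"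
      using p by (intro sum_mono) (auto simp: h_def field_simps)
    also have "\<dots> = ln (real p) / real p + ln (real p) * (\<Sum>k=2..N. (1 / real p) ^ k)"
      using False by (subst sum.atLeast_Suc_atMost) (auto simp: sum_distrib_left numeral_2_eq_2)
    also have "\<dots> \<le> ln (real p) / real p + ln (real p) * (2 / (real p * sqrt (real p)))"
      using p by (intro add_left_mono mult_left_mono sum_higher_powers_le) auto
    finally show "(\<Sum>k=1..N. h (p ^ k))
        \<le> ln (real p) / real p + 2 * (ln (real p) ^ 1 / (real p * sqrt (real p)))"
      by (simp add: mult.commute)
  qed
  also have "\<dots> = (\<Sum>p\<in>?P. ln (real p) / real p)
      + 2 * (\<Sum>p\<in>?P. ln (real p) ^ 1 / (real p * sqrt (real p)))"
    by (simp add: sum.distrib sum_distrib_left)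
  also have "\<dots> \<le> (\<Sum>p\<in>?P. ln (real p) / real p) + 2 * ln_power_series 1"
    by (intro add_left_mono mult_left_mono sum_ln_power_over_le) auto
  finally show ?thesis .
qed (simp add: ln_power_series_nonneg)

lemma le_nat_floor_exp_iff:
  assumes "n > 0"
  shows "n \<le> nat \<lfloor>exp t\<rfloor> \<longleftrightarrow> ln (real n) \<le> t"
proof -
  have "n \<le> nat \<lfloor>exp t\<rfloor> \<longleftrightarrow> real n \<le> exp t"
    by (simp add: le_nat_iff le_floor_iff)
  also have "\<dots> \<longleftrightarrow> ln (real n) \<le> t"
    using assms ln_le_cancel_iff[of "real n" "exp t"] by simp
  finally show ?thesis .
qed

lemma primes_ln_le_eq:
  "{p. prime p \<and> ln (real p) \<le> t} = {p. prime p \<and> p \<le> nat \<lfloor>exp t\<rfloor>}"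
  using le_nat_floor_exp_iff[OF prime_gt_0_nat] by blast

lemma finite_primes_ln_le: "finite {p. prime p \<and> ln (real p) \<le> t}"
  unfolding primes_ln_le_eq by simp

lemma ln_nat_floor_exp_bounds:
  assumes "t \<ge> 0"
  shows "nat \<lfloor>exp t\<rfloor> > 0" "ln (real (nat \<lfloor>exp t\<rfloor>)) \<le> t" "t - 1 \<le> ln (real (nat \<lfloor>exp t\<rfloor>))"
proof -
  let ?N = "nat \<lfloor>exp t\<rfloor>"
  have "exp t \<ge> 1" using assms by simp
  then have floor_bounds: "?N > 0" "exp t < real ?N + 1" by linarith+
  show "?N > 0" by fact
  show "ln (real ?N) \<le> t" using le_nat_floor_exp_iff[OF floor_bounds(1), of t] by simp
  have "exp t \<le> 2 * real ?N" using floor_bounds by linarith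
  also have "\<dots> \<le> exp 1 * real ?N" using exp_ge_add_one_self[of 1] by (intro mult_right_mono) auto
  finally have "t \<le> ln (exp 1 * real ?N)" using floor_bounds by (subst ln_ge_iff) auto
  also have "ln (exp 1 * real ?N) = 1 + ln (real ?N)" using floor_bounds by (subst ln_mult_pos) auto
  finally show "t - 1 \<le> ln (real ?N)" by simp
qed

definition mertens_sum :: "real \<Rightarrow> real" where
  "mertens_sum t = (\<Sum>p | prime p \<and> ln (real p) \<le> t. ln (real p) / real p)"

lemma mertens_first: "\<exists>C\<ge>0. \<forall>t\<ge>0. \<bar>mertens_sum t - t\<bar> \<le> C"
proof (intro exI[of _ "8 + 2 * ln_power_series 1"] conjI allI impI)
  show "8 + 2 * ln_power_series 1 \<ge> 0" using ln_power_series_nonneg[of 1] by simp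
  fix t :: real assume "t \<ge> 0"
  let ?N = "nat \<lfloor>exp t\<rfloor>"
  have floor_bounds: "?N > 0" "ln (real ?N) \<le> t" "t - 1 \<le> ln (real ?N)"
    using ln_nat_floor_exp_bounds[OF \<open>t \<ge> 0\<close>] by auto
  show "\<bar>mertens_sum t - t\<bar> \<le> 8 + 2 * ln_power_series 1"
    unfolding mertens_sum_def primes_ln_le_eq
    using sum_mangoldt_over_le[OF floor_bounds(1)] sum_mangoldt_over_ge[OF floor_bounds(1)]
      sum_primes_over_le_sum_mangoldt_over[of ?N] sum_mangoldt_over_le_sum_primes_over[of ?N]
      floor_bounds ln_power_series_nonneg[of 1]
    by linarith
qed

section \<open>The variance as a sum over primes\<close>

lemma has_integral_derivative_tail:
  fixes h h' :: "real \<Rightarrow> 'a::banach"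
  assumes y_in: "y \<in> {0..b}"
    and deriv: "\<And>u. u \<in> {0..b} \<Longrightarrow> (h has_vector_derivative h' u) (at u within {0..b})"
    and "h b = 0"
  shows "((\<lambda>u. if y \<le> u then h' u else 0) has_integral - h y) {0..b}"
proof -
  have "(h' has_integral (h b - h y)) {y..b}"
    using y_in by (intro fundamental_theorem_of_calculus
        has_vector_derivative_within_subset[OF deriv]) auto
  then have "((\<lambda>u. if u \<in> {y..b} then h' u else 0) has_integral - h y) {0..b}"
    using y_in \<open>h b = 0\<close> by (subst has_integral_restrict) auto
  then show ?thesis by (rule has_integral_eq[rotated]) auto
qed

lemma has_integral_ident_times_derivative:
  fixes h h' :: "real \<Rightarrow> 'a::banach"
  assumes "0 \<le> b"
    and deriv: "\<And>u. u \<in> {0..b} \<Longrightarrow> (h has_vector_derivative h' u) (at u within {0..b})"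
    and "h b = 0"
  shows "((\<lambda>u. u *\<^sub>R h' u) has_integral - integral {0..b} h) {0..b}"
proof -
  have product: "((\<lambda>u. h u + u *\<^sub>R h' u) has_integral (b *\<^sub>R h b - 0 *\<^sub>R h 0)) {0..b}"
  proof (rule fundamental_theorem_of_calculus[OF assms(1)])
    fix x assume x: "x \<in> {0..b}"
    show "((\<lambda>u. u *\<^sub>R h u) has_vector_derivative h x + x *\<^sub>R h' x) (at x within {0..b})"
      by (rule derivative_eq_intros deriv[OF x] refl | simp)+
  qed
  have "(h has_integral integral {0..b} h) {0..b}"
    using continuous_on_vector_derivative[OF deriv]
    by (intro integrable_integral integrable_continuous_interval)
  from has_integral_diff[OF product this] show ?thesis
    using \<open>h b = 0\<close> by simp
qed

text \<open>Abel summation: each \<open>h (y i)\<close> is minus an integral of \<open>h'\<close>, so the weighted sum is minus the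
  integral of \<open>h'\<close> against the counting function of the weights, which is the identity up to \<open>C\<close>.\<close>

lemma weighted_sum_near_integral:
  fixes h h' :: "real \<Rightarrow> 'a::banach" and a y :: "'i \<Rightarrow> real"
  assumes "0 \<le> b" and indices: "finite I" "\<And>i. i \<in> I \<Longrightarrow> y i \<in> {0..b}"
    and count: "\<And>u. u \<in> {0..b} \<Longrightarrow> \<bar>(\<Sum>i | i \<in> I \<and> y i \<le> u. a i) - u\<bar> \<le> C"
    and deriv: "\<And>u. u \<in> {0..b} \<Longrightarrow> (h has_vector_derivative h' u) (at u within {0..b})"
    and bound: "\<And>u. u \<in> {0..b} \<Longrightarrow> norm (h' u) \<le> B"
    and "h b = 0"
  shows "norm ((\<Sum>i\<in>I. a i *\<^sub>R h (y i)) - integral {0..b} h) \<le> C * B * b"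
proof -
  let ?g = "\<lambda>u. (\<Sum>i\<in>I. a i *\<^sub>R (if y i \<le> u then h' u else 0)) - u *\<^sub>R h' u"
  have g_eq: "?g u = ((\<Sum>i | i \<in> I \<and> y i \<le> u. a i) - u) *\<^sub>R h' u" for u
  proof -
    have "(\<Sum>i\<in>I. a i *\<^sub>R (if y i \<le> u then h' u else 0))
        = (\<Sum>i\<in>I. if y i \<le> u then a i *\<^sub>R h' u else 0)"
      by (intro sum.cong) auto
    also have "\<dots> = (\<Sum>i | i \<in> I \<and> y i \<le> u. a i *\<^sub>R h' u)"
      by (rule sum.inter_filter[OF indices(1), symmetric])
    also have "\<dots> = (\<Sum>i | i \<in> I \<and> y i \<le> u. a i) *\<^sub>R h' u"
      by (rule scaleR_sum_left[symmetric])
    finally show ?thesis by (simp add: scaleR_left_diff_distrib)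
  qed
  have "C * B \<ge> 0"
    using order_trans[OF abs_ge_zero count[of 0]] order_trans[OF norm_ge_zero bound[of 0]] \<open>0 \<le> b\<close>
    by simp
  moreover have "(?g has_integral (\<Sum>i\<in>I. a i *\<^sub>R - h (y i)) - - integral {0..b} h) {0..b}"
    using assms by (intro has_integral_diff has_integral_sum has_integral_cmul
        has_integral_derivative_tail has_integral_ident_times_derivative)
  moreover have "norm (?g u) \<le> C * B" if "u \<in> {0..b}" for u
    unfolding g_eq norm_scaleR using count[OF that] bound[OF that]
    by (intro mult_mono) (auto intro: order_trans[OF abs_ge_zero])
  ultimately have "norm ((\<Sum>i\<in>I. a i *\<^sub>R - h (y i)) - - integral {0..b} h)
      \<le> C * B * measure lborel {0..b}"
    by (intro has_integral_bound_real[of _ "{}" ?g]) auto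
  also have "(\<Sum>i\<in>I. a i *\<^sub>R - h (y i)) - - integral {0..b} h
      = - ((\<Sum>i\<in>I. a i *\<^sub>R h (y i)) - integral {0..b} h)"
    by (simp add: sum_negf)
  finally show ?thesis
    using \<open>0 \<le> b\<close> by (simp only: norm_minus_cancel) simp
qed

lemma sum_over_primes_near_integral:
  fixes h h' :: "real \<Rightarrow> 'a::banach"
  assumes b_nonneg: "0 \<le> b"
    and deriv: "\<And>u. u \<in> {0..b} \<Longrightarrow> (h has_vector_derivative h' u) (at u within {0..b})"
    and cont: "continuous_on {0..b} h'" and "h b = 0"
  shows "\<exists>C. \<forall>L>0. norm ((\<Sum>p | prime p \<and> ln (real p) \<le> b * L.
      (ln (real p) / real p / L) *\<^sub>R h (ln (real p) / L)) - integral {0..b} h) \<le> C / L"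
proof -
  obtain C where mertens: "\<And>t. t \<ge> 0 \<Longrightarrow> \<bar>mertens_sum t - t\<bar> \<le> C"
    using mertens_first by blast
  have "bounded (h' ` {0..b})"
    by (intro compact_imp_bounded compact_continuous_image cont compact_Icc)
  then obtain B where deriv_bound: "\<And>u. u \<in> {0..b} \<Longrightarrow> norm (h' u) \<le> B"
    unfolding bounded_iff by blast
  have "norm ((\<Sum>p | prime p \<and> ln (real p) \<le> b * L.
      (ln (real p) / real p / L) *\<^sub>R h (ln (real p) / L)) - integral {0..b} h) \<le> C / L * B * b"
    if L_pos: "L > 0" for L
  proof (rule weighted_sum_near_integral[OF b_nonneg finite_primes_ln_le _ _ deriv deriv_bound
        \<open>h b = 0\<close>])
    let ?P = "{p. prime p \<and> ln (real p) \<le> b * L}"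
    show "ln (real p) / L \<in> {0..b}" if "p \<in> ?P" for p
      using that L_pos prime_ge_1_nat[of p] by (auto simp: field_simps)
    fix u assume u: "u \<in> {0..b}"
    then have uL_le: "u * L \<le> b * L" using L_pos by simp
    have "{p \<in> ?P. ln (real p) / L \<le> u} = {p. prime p \<and> ln (real p) \<le> u * L}"
      using L_pos by (auto simp: pos_divide_le_eq intro: order_trans[OF _ uL_le])
    then have "(\<Sum>p | p \<in> ?P \<and> ln (real p) / L \<le> u. ln (real p) / real p / L)
        = mertens_sum (u * L) / L"
      by (simp add: mertens_sum_def sum_divide_distrib)
    also have "mertens_sum (u * L) / L - u = (mertens_sum (u * L) - u * L) / L"
      using L_pos by (simp add: field_simps)
    finally show "\<bar>(\<Sum>p | p \<in> ?P \<and> ln (real p) / L \<le> u. ln (real p) / real p / L) - u\<bar> \<le> C / L"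
      using mertens[of "u * L"] u L_pos by (simp add: divide_right_mono)
  qed auto
  then show ?thesis
    by (intro exI[of _ "C * B * b"]) simp
qed

lemma fourier_even:
  assumes "\<And>x. f (- x) = f x"
  shows "fourier f (- u) = fourier f u"
  unfolding fourier_def
  by (subst lborel_integral_real_affine[of "-1" _ 0]) (auto simp: assms)

lemma norm_fourier_le: "cmod (fourier f u) \<le> (LINT x|lborel. \<bar>f x\<bar>)"
proof -
  have "cmod (fourier f u)
      \<le> (LINT x|lborel.
        cmod (complex_of_real (f x) * exp (- 2 * pi * \<i> * complex_of_real (x * u))))"
    unfolding fourier_def by (rule integral_norm_bound)
  also have "\<dots> = (LINT x|lborel. \<bar>f x\<bar>)"
    by (simp add: norm_mult norm_exp_eq_Re)
  finally show ?thesis .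
qed

lemma eq_0_if_notin_supp: "u \<notin> supp g \<Longrightarrow> g u = 0"
  unfolding supp_def using closure_subset[of "{u. g u \<noteq> 0}"] by blast

lemma smooth_fun_has_vector_derivative:
  assumes "smooth_fun g"
  obtains g' where "\<And>u. (g has_vector_derivative g' u) (at u)" "continuous_on UNIV g'"
proof
  let ?R = "\<lambda>t. Re (g t)" and ?I = "\<lambda>t. Im (g t)"
  define g' where "g' u = of_real (deriv ?R u) + \<i> * of_real (deriv ?I u)" for u
  have iterates: "((deriv ^^ k) ?R) differentiable (at x)"
    "((deriv ^^ k) ?I) differentiable (at x)" for k x
    using assms unfolding smooth_fun_def by blast+
  show "(g has_vector_derivative g' u) (at u)" for u
  proof -
    have "(?R has_field_derivative deriv ?R u) (at u)" "(?I has_field_derivative deriv ?I u) (at u)"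
      using iterates[of 0] by (simp_all add: DERIV_deriv_iff_real_differentiable)
    then have "((\<lambda>t. of_real (?R t) + \<i> * of_real (?I t)) has_vector_derivative g' u) (at u)"
      unfolding g'_def
      by (intro has_vector_derivative_add has_vector_derivative_mult_right
          has_vector_derivative_of_real)
    then show ?thesis by (simp flip: complex_eq)
  qed
  show "continuous_on UNIV g'"
    unfolding g'_def using iterates[of 1]
    by (intro continuous_intros differentiable_imp_continuous_on) (auto simp: differentiable_on_def)
qed

text \<open>With \<open>L = ln T\<close>, this is the coefficient of the frequencies \<open>\<plusminus>ln n\<close> in \<open>N_osc f T\<close>.\<close>

definition osc_coeff :: "(real \<Rightarrow> real) \<Rightarrow> real \<Rightarrow> nat \<Rightarrow> complex" where
  "osc_coeff f L n = - (mangoldt n / of_real (sqrt (real n) * L)) * fourier f (ln (real n) / L)"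

lemma osc_coeff_prime_squared:
  assumes "prime p"
  shows "(osc_coeff f L p)\<^sup>2 = (ln (real p) / real p / L) *\<^sub>R
    (of_real (ln (real p) / L) * (fourier f (ln (real p) / L))\<^sup>2)"
proof -
  have "osc_coeff f L p
      = - (of_real (ln (real p) / (sqrt (real p) * L)) * fourier f (ln (real p) / L))"
    using assms by (simp add: osc_coeff_def)
  then have "(osc_coeff f L p)\<^sup>2
      = of_real ((ln (real p) / (sqrt (real p) * L))\<^sup>2) * (fourier f (ln (real p) / L))\<^sup>2"
    by (simp only: power2_minus power_mult_distrib of_real_power)
  also have "(ln (real p) / (sqrt (real p) * L))\<^sup>2 = ln (real p) / real p / L * (ln (real p) / L)"
    by (simp add: power2_eq_square)
  finally show ?thesis
    by (simp add: scaleR_conv_of_real mult_ac)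
qed

locale test_function =
  fixes f :: "real \<Rightarrow> real" and \<alpha> :: real
  assumes \<alpha>_pos: "0 < \<alpha>" and \<alpha>_le_1: "\<alpha> \<le> 1"
    and even: "\<And>x. f (- x) = f x"
    and smooth: "smooth_fun (fourier f)"
    and supp_subset: "supp (fourier f) \<subseteq> {- \<alpha><..<\<alpha>}"
begin

lemma fourier_eq_0: "\<bar>u\<bar> \<ge> \<alpha> \<Longrightarrow> fourier f u = 0"
  using subsetD[OF supp_subset, of u] by (intro eq_0_if_notin_supp) auto

lemma continuous_on_fourier: "continuous_on A (fourier f)"
proof -
  obtain D where "\<And>u. (fourier f has_vector_derivative D u) (at u)"
    using smooth_fun_has_vector_derivative[OF smooth] by blast
  then show ?thesis
    by (meson continuous_at_imp_continuous_on has_vector_derivative_continuous)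
qed

lemma sigma2_eq_integral: "sigma2 f = 2 * integral {0..\<alpha>} (\<lambda>u. of_real u * (fourier f u)\<^sup>2)"
proof -
  let ?k = "\<lambda>u. complex_of_real (min \<bar>u\<bar> 1) * (fourier f u)\<^sup>2"
  have k_cont: "continuous_on A ?k" for A
    by (intro continuous_intros continuous_on_fourier)
  have "sigma2 f = (LINT u:{-\<alpha>..\<alpha>}|lborel. ?k u)"
    unfolding sigma2_def set_lebesgue_integral_def
    by (intro Bochner_Integration.integral_cong refl) (auto simp: indicator_def fourier_eq_0)
  also have "\<dots> = integral {-\<alpha>..\<alpha>} ?k"
    by (intro set_borel_integral_eq_integral(2) borel_integrable_atLeastAtMost' k_cont)
  also have "\<dots> = integral {-\<alpha>..0} ?k + integral {0..\<alpha>} ?k"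
    using \<alpha>_pos by (intro Henstock_Kurzweil_Integration.integral_combine[symmetric]
        integrable_continuous_interval k_cont) auto
  also have "integral {-\<alpha>..0} ?k = integral {-\<alpha>..-0} (\<lambda>u. ?k (- u))"
    by (simp add: fourier_even[of f, OF even])
  also have "\<dots> = integral {0..\<alpha>} ?k"
    by (rule Henstock_Kurzweil_Integration.integral_reflect_real)
  also have "integral {0..\<alpha>} ?k = integral {0..\<alpha>} (\<lambda>u. of_real u * (fourier f u)\<^sup>2)"
    using \<alpha>_le_1 by (intro Henstock_Kurzweil_Integration.integral_cong) auto
  finally show ?thesis by simp
qed

lemma prime_variance_asymptotic:
  "(\<lambda>L. (\<Sum>p | prime p \<and> ln (real p) \<le> \<alpha> * L. 2 * (osc_coeff f L p)\<^sup>2) - sigma2 f)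
    \<in> O(\<lambda>L. of_real (1 / L))"
proof -
  obtain D where fourier_deriv: "\<And>u. (fourier f has_vector_derivative D u) (at u)"
    "continuous_on UNIV D"
    using smooth_fun_has_vector_derivative[OF smooth] by blast
  define h where "h u = of_real u * (fourier f u)\<^sup>2" for u
  define h' where "h' u = (fourier f u)\<^sup>2 + of_real u * (2 * fourier f u * D u)" for u
  have "(h has_vector_derivative h' u) (at u within {0..\<alpha>})" for u
    unfolding h_def[abs_def] h'_def power2_eq_square
    by (rule derivative_eq_intros has_vector_derivative_at_within[OF fourier_deriv(1)] refl
        | simp add: algebra_simps)+
  moreover have "continuous_on {0..\<alpha>} h'"
    unfolding h'_def
    by (intro continuous_intros continuous_on_fourier continuous_on_subset[OF fourier_deriv(2)])
       auto
  moreover have "h \<alpha> = 0" using fourier_eq_0[of \<alpha>] by (simp add: h_def)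
  ultimately obtain C where sum_approx: "\<And>L. L > 0 \<Longrightarrow>
      cmod ((\<Sum>p | prime p \<and> ln (real p) \<le> \<alpha> * L.
        (ln (real p) / real p / L) *\<^sub>R h (ln (real p) / L)) - integral {0..\<alpha>} h) \<le> C / L"
    using sum_over_primes_near_integral[of \<alpha> h h'] \<alpha>_pos by auto
  have "cmod ((\<Sum>p | prime p \<and> ln (real p) \<le> \<alpha> * L. 2 * (osc_coeff f L p)\<^sup>2) - sigma2 f)
      \<le> 2 * C * cmod (of_real (1 / L))" if L_pos: "L > 0" for L
  proof -
    have "(\<Sum>p | prime p \<and> ln (real p) \<le> \<alpha> * L. 2 * (osc_coeff f L p)\<^sup>2)
        = 2 * (\<Sum>p | prime p \<and> ln (real p) \<le> \<alpha> * L.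
          (ln (real p) / real p / L) *\<^sub>R h (ln (real p) / L))"
      unfolding sum_distrib_left
      by (intro sum.cong refl) (simp only: mem_Collect_eq h_def osc_coeff_prime_squared)
    moreover have "sigma2 f = 2 * integral {0..\<alpha>} h"
      unfolding h_def by (rule sigma2_eq_integral)
    ultimately show ?thesis
      using sum_approx[OF L_pos] L_pos
      by (simp only: right_diff_distrib[symmetric] norm_mult) (simp add: norm_divide)
  qed
  then show ?thesis
    by (intro bigoI[of _ "2 * C"] eventually_mono[OF eventually_gt_at_top[of 0]])
qed

end

section \<open>Averages of trigonometric polynomials\<close>

lemma wavg_trig_poly:
  assumes H_pos: "H > 0" and w_integrable: "integrable lborel w"
  shows "wavg w T H (trig_poly F)
       = (\<Sum>x\<in>freqs F. coef F x * cis (T * x) * fourier w (- (H * x / (2 * pi))))"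
proof -
  have integrable_w_cis: "integrable lborel (\<lambda>y. complex_of_real (w y) * cis (H * x * y))" for x
  proof (rule Bochner_Integration.integrable_bound[OF w_integrable])
    have "(\<lambda>y. cis (H * x * y)) \<in> borel_measurable borel"
      by (intro borel_measurable_continuous_onI continuous_intros)
    then show "(\<lambda>y. complex_of_real (w y) * cis (H * x * y)) \<in> borel_measurable lborel"
      using w_integrable by auto
  qed (auto simp: norm_mult)
  have "wavg w T H (trig_poly F)
      = \<bar>H\<bar> *\<^sub>R (LINT y|lborel.
        trig_poly F (T + H * y) * complex_of_real (w ((T + H * y - T) / H) / H))"
    unfolding wavg_def using H_pos by (subst lborel_integral_real_affine[of H _ T]) auto
  also have "\<dots> = (LINT y|lborel. (\<Sum>x\<in>freqs F.
      coef F x * cis (T * x) * (complex_of_real (w y) * cis (H * x * y))))"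
    unfolding integral_scaleR_right[symmetric]
    using H_pos by (intro Bochner_Integration.integral_cong refl)
      (simp add: trig_poly_def scaleR_conv_of_real sum_distrib_left sum_distrib_right ring_distribs
                 cis_mult[symmetric] mult_ac)
  also have "\<dots> = (\<Sum>x\<in>freqs F. coef F x * cis (T * x)
      * (LINT y|lborel. complex_of_real (w y) * cis (H * x * y)))"
    by (simp add: Bochner_Integration.integral_sum integrable_mult_right integrable_w_cis)
  also have "\<dots> = (\<Sum>x\<in>freqs F. coef F x * cis (T * x) * fourier w (- (H * x / (2 * pi))))"
    unfolding fourier_def cis_conv_exp by (simp add: mult_ac)
  finally show ?thesis .
qed

lemma wavg_trig_poly_eq_coef_0:
  assumes "H > 0" and w_density: "integrable lborel w" "(LINT x|lborel. w x) = 1"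
    and band: "\<And>u. \<bar>u\<bar> > B \<Longrightarrow> fourier w u = 0"
    and gap: "\<And>x. x \<in> freqs F \<Longrightarrow> x \<noteq> 0 \<Longrightarrow> H * \<bar>x\<bar> > 2 * pi * B"
  shows "wavg w T H (trig_poly F) = coef F 0"
proof -
  have "wavg w T H (trig_poly F)
      = (\<Sum>x\<in>freqs F. coef F x * cis (T * x) * fourier w (- (H * x / (2 * pi))))"
    by (rule wavg_trig_poly[OF assms(1) w_density(1)])
  also have "\<dots> = (\<Sum>x\<in>freqs F. if x = 0 then coef F x else 0)"
  proof (intro sum.cong refl)
    fix x assume x: "x \<in> freqs F"
    show "coef F x * cis (T * x) * fourier w (- (H * x / (2 * pi)))
        = (if x = 0 then coef F x else 0)"
    proof (cases "x = 0")
      case True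
      then show ?thesis using w_density by (simp add: fourier_def)
    next
      case False
      have "\<bar>- (H * x / (2 * pi))\<bar> = H * \<bar>x\<bar> / (2 * pi)"
        using assms(1) by (simp add: abs_mult)
      also have "\<dots> > B"
        using gap[OF x False] by (simp add: pos_less_divide_eq mult_ac)
      finally show ?thesis using band False by simp
    qed
  qed
  also have "\<dots> = coef F 0" by (auto simp: in_keys_iff)
  finally show ?thesis .
qed

definition log_ratios :: "real \<Rightarrow> real set" where
  "log_ratios Y = {ln (real a) - ln (real b) |a b. a > 0 \<and> b > 0 \<and> real a * real b \<le> Y}"

lemma ln_nat_diff_ge:
  fixes a b :: nat
  assumes "a > b" "b > 0" "real a * real b \<le> Y"
  shows "ln (real a) - ln (real b) \<ge> 1 / (2 * sqrt Y)"
proof -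
  have "(real b)\<^sup>2 \<le> real a * real b" using assms by (simp add: power2_eq_square)
  also note assms(3)
  finally have "real b \<le> sqrt Y" by (rule real_le_rsqrt)
  moreover from this have "0 < sqrt Y" using assms by linarith
  ultimately have "1 / (2 * sqrt Y) \<le> 1 / (2 * real b)"
    using assms by (intro divide_left_mono mult_pos_pos mult_left_mono) auto
  also have "\<dots> \<le> 1 / (real b + 1)" using assms by (intro divide_left_mono) auto
  also have "\<dots> = 1 - real b / (real b + 1)" by (simp add: field_simps)
  also have "\<dots> \<le> - ln (real b / (real b + 1))"
    using assms ln_le_minus_one[of "real b / (real b + 1)"] by simp
  also have "\<dots> = ln (real b + 1) - ln (real b)" using assms by (simp add: ln_div)
  also have "\<dots> \<le> ln (real a) - ln (real b)" using assms by simp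
  finally show ?thesis .
qed

lemma log_ratios_gap:
  assumes "x \<in> log_ratios Y" "x \<noteq> 0"
  shows "\<bar>x\<bar> \<ge> 1 / (2 * sqrt Y)"
proof -
  obtain a b where x_ratio: "x = ln (real a) - ln (real b)" "a > 0" "b > 0" "real a * real b \<le> Y"
    using assms(1) unfolding log_ratios_def by blast
  then consider "a > b" | "b > a"
    using assms(2) by fastforce
  then show ?thesis
    using ln_nat_diff_ge[of b a Y] ln_nat_diff_ge[of a b Y] x_ratio
    by cases (auto simp: mult.commute)
qed

lemma log_ratios_add_ln:
  assumes "x = ln (real n) \<or> x = - ln (real n)" "n > 0" "real n \<le> Z" "y \<in> log_ratios Y"
  shows "x + y \<in> log_ratios (Z * Y)"
proof -
  obtain a b where y_ratio: "y = ln (real a) - ln (real b)" "a > 0" "b > 0" "real a * real b \<le> Y"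
    using assms(4) unfolding log_ratios_def by blast
  have bound: "real n * (real a * real b) \<le> Z * Y"
    using assms y_ratio by (intro mult_mono) auto
  from assms(1) show ?thesis
  proof
    assume "x = ln (real n)"
    then have "x + y = ln (real (n * a)) - ln (real b)" using y_ratio assms by (simp add: ln_mult)
    then show ?thesis unfolding log_ratios_def using y_ratio assms bound
      by (intro CollectI exI[of _ "n * a"] exI[of _ b]) (auto simp: mult_ac)
  next
    assume "x = - ln (real n)"
    then have "x + y = ln (real a) - ln (real (n * b))" using y_ratio assms by (simp add: ln_mult)
    then show ?thesis unfolding log_ratios_def using y_ratio assms bound
      by (intro CollectI exI[of _ a] exI[of _ "n * b"]) (auto simp: mult_ac)
  qed
qed

section \<open>Coefficients supported on prime powers\<close>

definition log_wave :: "nat \<Rightarrow> complex \<Rightarrow> (real \<Rightarrow>\<^sub>0 complex)" where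
  "log_wave n z = wave (ln (real n)) z + wave (- ln (real n)) z"

lemma log_wave_0 [simp]: "log_wave n 0 = 0"
  by (simp add: log_wave_def)

lemma trig_poly_log_wave:
  "trig_poly (log_wave n z) \<tau> = z * (cis (\<tau> * ln (real n)) + cis (- (\<tau> * ln (real n))))"
  by (simp add: log_wave_def trig_poly_add ring_distribs)

lemma freqs_log_wave: "freqs (log_wave n z) \<subseteq> {ln (real n), - ln (real n)}"
  unfolding log_wave_def using keys_add[of "wave (ln (real n)) z" "wave (- ln (real n)) z"]
  by (auto split: if_splits)

lemma l1_norm_log_wave: "l1_norm (log_wave n z) \<le> 2 * cmod z"
  unfolding log_wave_def by (rule order_trans[OF l1_norm_add]) simp

lemma coef_0_log_wave: "n > 1 \<Longrightarrow> coef (log_wave n z) 0 = 0"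
  by (simp add: log_wave_def lookup_add lookup_single when_def)

lemma coef_0_log_wave_squared:
  assumes "n > 1"
  shows "coef (log_wave n z ^ 2) 0 = 2 * z\<^sup>2"
proof -
  have "log_wave n z ^ 2 = wave (2 * ln (real n)) (z * z) + wave (- 2 * ln (real n)) (z * z)
      + 2 * wave 0 (z * z)"
    by (simp add: log_wave_def power2_eq_square ring_distribs mult_single ac_simps)
  then show ?thesis
    using assms coef_of_nat_mult[of 2 "wave (0::real) (z * z)" 0]
    by (simp add: lookup_add lookup_single when_def power2_eq_square)
qed

definition log_poly :: "(nat \<Rightarrow> complex) \<Rightarrow> nat \<Rightarrow> (real \<Rightarrow>\<^sub>0 complex)" where
  "log_poly c N = (\<Sum>n\<le>N. log_wave n (c n))"

definition local_poly :: "(nat \<Rightarrow> complex) \<Rightarrow> nat \<Rightarrow> nat \<Rightarrow> (real \<Rightarrow>\<^sub>0 complex)" where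
  "local_poly c N p = (\<Sum>k=1..N. log_wave (p ^ k) (c (p ^ k)))"

definition log_poly_variance :: "(nat \<Rightarrow> complex) \<Rightarrow> nat \<Rightarrow> complex" where
  "log_poly_variance c N = (\<Sum>p | prime p \<and> p \<le> N. coef (local_poly c N p ^ 2) 0)"

lemma freqs_log_poly_power:
  assumes "c 0 = 0" "real N \<le> Z"
  shows "freqs (log_poly c N ^ m) \<subseteq> log_ratios (Z ^ m)"
proof (rule freqs_power_subset)
  show "0 \<in> log_ratios (Z ^ 0)"
    unfolding log_ratios_def by (auto intro!: exI[of _ 1])
  fix k x y assume x_freq: "x \<in> freqs (log_poly c N)" and y_ratio: "y \<in> log_ratios (Z ^ k)"
  obtain n where n_wave: "n \<le> N" "x \<in> freqs (log_wave n (c n))"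
    using x_freq keys_sum[of "\<lambda>n. log_wave n (c n)" "{..N}"] unfolding log_poly_def by auto
  then have "n > 0"
    using assms(1) by (intro Nat.gr0I) simp
  moreover have "x = ln (real n) \<or> x = - ln (real n)"
    using freqs_log_wave n_wave(2) by blast
  ultimately show "x + y \<in> log_ratios (Z ^ Suc k)"
    using n_wave(1) assms(2) y_ratio by (auto intro!: log_ratios_add_ln)
qed

lemma freqs_local_poly:
  assumes "prime p"
  shows "freqs (local_poly c N p) \<subseteq> log_fractions {p}"
proof -
  have "freqs (log_wave (p ^ k) z) \<subseteq> log_fractions {p}" for k z
    using freqs_log_wave[of "p ^ k" z] ln_prime_power_in_log_fractions[OF assms]
      add_subgroup_uminus[OF add_subgroup_log_fractions] by blast
  then show ?thesis
    unfolding local_poly_def using keys_sum[of "\<lambda>k. log_wave (p ^ k) (c (p ^ k))" "{1..N}"] by blast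
qed

lemma coef_0_local_poly:
  assumes "prime p"
  shows "coef (local_poly c N p) 0 = 0"
  unfolding local_poly_def lookup_sum
proof (intro sum.neutral ballI coef_0_log_wave)
  show "p ^ k > 1" if "k \<in> {1..N}" for k
    using assms that by (intro one_less_power prime_gt_1_nat) auto
qed

locale prime_power_coeffs =
  fixes c :: "nat \<Rightarrow> complex" and N :: nat and A :: real
  assumes N_pos: "N > 0" and A_nonneg: "A \<ge> 0"
    and non_primepow: "\<And>n. \<not> primepow n \<Longrightarrow> c n = 0"
    and large: "\<And>n. n > N \<Longrightarrow> c n = 0"
    and coeff_bound: "\<And>p k. prime p \<Longrightarrow> k > 0 \<Longrightarrow>
      cmod (c (p ^ k)) \<le> A * ln (real p) * (1 / sqrt (real p)) ^ k"
begin

lemma log_poly_eq_sum_local_poly: "log_poly c N = (\<Sum>p | prime p \<and> p \<le> N. local_poly c N p)"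
  unfolding log_poly_def local_poly_def
  by (rule sum_over_prime_powers) (simp_all add: non_primepow large)

lemma moment_fps_log_poly:
  "moment_fps (log_poly c N) = (\<Prod>p | prime p \<and> p \<le> N. moment_fps (local_poly c N p))"
  unfolding log_poly_eq_sum_local_poly by (intro moment_fps_sum freqs_local_poly) auto

text \<open>The powers of \<open>p\<close> contribute a geometric series of ratio \<open>1 / sqrt p \<le> 3 / 4\<close>, whence
  the factor \<open>8 = 2 / (1 - 3 / 4)\<close>.\<close>

lemma l1_norm_local_tail_le:
  assumes p: "prime p" and "j > 0"
  shows "l1_norm (\<Sum>k=j..N. log_wave (p ^ k) (c (p ^ k)))
    \<le> 8 * A * ln (real p) * (1 / sqrt (real p)) ^ j"
proof -
  let ?x = "1 / sqrt (real p)"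
  have "real p \<ge> 2" using prime_ge_2_nat[OF p] by simp
  then have "4 / 3 \<le> sqrt (real p)" by (intro real_le_rsqrt) (simp add: power2_eq_square)
  then have "?x \<le> 1 / (4 / 3)" using \<open>real p \<ge> 2\<close> by (intro divide_left_mono) auto
  then have ratio: "0 \<le> ?x" "?x \<le> 3 / 4" by auto
  have ln_p_nonneg: "ln (real p) \<ge> 0" using \<open>real p \<ge> 2\<close> by simp
  have "l1_norm (\<Sum>k=j..N. log_wave (p ^ k) (c (p ^ k)))
      \<le> (\<Sum>k=j..N. l1_norm (log_wave (p ^ k) (c (p ^ k))))"
    by (rule l1_norm_sum)
  also have "\<dots> \<le> (\<Sum>k=j..N. 2 * (A * ln (real p) * ?x ^ k))"
    using assms by (intro sum_mono order_trans[OF l1_norm_log_wave] mult_left_mono coeff_bound) auto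
  also have "\<dots> = 2 * A * ln (real p) * (\<Sum>k=j..N. ?x ^ k)"
    by (simp add: sum_distrib_left mult_ac)
  also have "\<dots> \<le> 2 * A * ln (real p) * (?x ^ j / (1 - ?x))"
    using ratio A_nonneg ln_p_nonneg by (intro mult_left_mono sum_geometric_tail_le) auto
  also have "\<dots> \<le> 2 * A * ln (real p) * (?x ^ j / (1 / 4))"
    using ratio A_nonneg ln_p_nonneg by (intro mult_left_mono divide_left_mono) auto
  finally show ?thesis by simp
qed

definition majorant :: "nat \<Rightarrow> real" where
  "majorant p = 8 * A * ln (real p) / sqrt (real p)"

lemma majorant_nonneg: "prime p \<Longrightarrow> majorant p \<ge> 0"
  unfolding majorant_def using prime_ge_1_nat[of p] A_nonneg by simp

lemma majorant_le: "prime p \<Longrightarrow> majorant p \<le> 16 * A"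
proof -
  assume "prime p"
  then have p: "p > 0" by (rule prime_gt_0_nat)
  have "ln (real p) = 2 * ln (sqrt (real p))" using p by (simp add: ln_sqrt)
  also have "\<dots> \<le> 2 * (sqrt (real p) - 1)" using p by (intro mult_left_mono ln_le_minus_one) auto
  also have "\<dots> \<le> 2 * sqrt (real p)" by simp
  finally have "8 * A * ln (real p) \<le> 8 * A * (2 * sqrt (real p))"
    using A_nonneg by (intro mult_left_mono) auto
  then show ?thesis unfolding majorant_def using p by (simp add: field_simps)
qed

lemma l1_norm_local_poly_le: "prime p \<Longrightarrow> l1_norm (local_poly c N p) \<le> majorant p"
  using l1_norm_local_tail_le[of p 1] unfolding local_poly_def majorant_def by simp

lemma moment_near_gauss:
  "cmod (coef (log_poly c N ^ m) 0 / fact m - fps_nth (gauss_fps (log_poly_variance c N)) m)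
    \<le> 2 * (real (m + 1) * (1 + 16 * A) ^ m) * (\<Sum>p | prime p \<and> p \<le> N. majorant p ^ 3)
      * exp (real (m + 1) * (1 + 16 * A) ^ m * (\<Sum>p | prime p \<and> p \<le> N. majorant p ^ 2))"
proof -
  have "log_poly_variance c N
      = (\<Sum>p | prime p \<and> p \<le> N. 2 * fps_nth (moment_fps (local_poly c N p)) 2)"
    by (simp add: log_poly_variance_def moment_fps_def)
  moreover have "coef (log_poly c N ^ m) 0 / fact m = fps_nth (moment_fps (log_poly c N)) m"
    by (simp add: moment_fps_def)
  ultimately show ?thesis
    unfolding moment_fps_log_poly
    using prod_centred_fps_near_gauss[of "{p. prime p \<and> p \<le> N}" majorant
        "\<lambda>p. moment_fps (local_poly c N p)" "16 * A" m]
    by (simp add: centred_fps_moment_fps coef_0_local_poly l1_norm_local_poly_le majorant_le)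
qed

lemma sum_majorant_cubed_le:
  "(\<Sum>p | prime p \<and> p \<le> N. majorant p ^ 3) \<le> 512 * ln_power_series 3 * A ^ 3"
proof -
  have "(\<Sum>p | prime p \<and> p \<le> N. majorant p ^ 3)
      = 512 * A ^ 3 * (\<Sum>p | prime p \<and> p \<le> N. ln (real p) ^ 3 / (real p * sqrt (real p)))"
    unfolding sum_distrib_left majorant_def
    by (intro sum.cong refl) (simp add: power3_eq_cube field_simps)
  also have "\<dots> \<le> 512 * A ^ 3 * ln_power_series 3"
    using A_nonneg by (intro mult_left_mono sum_ln_power_over_le) auto
  finally show ?thesis by (simp add: mult_ac)
qed

lemma sum_majorant_squared_le:
  assumes mertens: "\<And>t. t \<ge> 0 \<Longrightarrow> \<bar>mertens_sum t - t\<bar> \<le> C"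
    and "C \<ge> 0" "A \<le> M" "A * ln (real N) \<le> D"
  shows "(\<Sum>p | prime p \<and> p \<le> N. majorant p ^ 2) \<le> 64 * (D * (D + M * C))"
proof -
  let ?P = "{p. prime p \<and> p \<le> N}"
  have ln_N_nonneg: "ln (real N) \<ge> 0" using N_pos by simp
  then have D_nonneg: "D \<ge> 0" using assms(4) A_nonneg by (meson mult_nonneg_nonneg order_trans)
  have "(\<Sum>p\<in>?P. majorant p ^ 2) = 64 * A\<^sup>2 * (\<Sum>p\<in>?P. ln (real p) * (ln (real p) / real p))"
    unfolding sum_distrib_left majorant_def
    by (intro sum.cong refl) (simp add: power2_eq_square field_simps)
  also have "\<dots> \<le> 64 * A\<^sup>2 * (\<Sum>p\<in>?P. ln (real N) * (ln (real p) / real p))"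
    using N_pos
    by (intro mult_left_mono sum_mono mult_right_mono) (auto simp: prime_gt_0_nat Suc_le_eq)
  also have "(\<Sum>p\<in>?P. ln (real N) * (ln (real p) / real p))
      = ln (real N) * mertens_sum (ln (real N))"
    unfolding mertens_sum_def sum_distrib_left
    using N_pos prime_gt_0_nat by (intro sum.cong) auto
  also have "64 * A\<^sup>2 * (ln (real N) * mertens_sum (ln (real N)))
      \<le> 64 * A\<^sup>2 * (ln (real N) * (ln (real N) + C))"
    using mertens[OF ln_N_nonneg] ln_N_nonneg by (intro mult_left_mono) auto
  also have "\<dots> = 64 * ((A * ln (real N)) * (A * ln (real N) + A * C))"
    by (simp add: power2_eq_square algebra_simps)
  also have "\<dots> \<le> 64 * (D * (D + M * C))"
    using assms ln_N_nonneg A_nonneg D_nonneg by (intro mult_left_mono mult_mono add_mono) auto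
  finally show ?thesis .
qed

lemma local_variance_near_prime_term:
  assumes "prime p"
  shows "cmod (coef (local_poly c N p ^ 2) 0 - 2 * (c p)\<^sup>2)
      \<le> 128 * A\<^sup>2 * (ln (real p) ^ 2 / (real p * sqrt (real p)))"
proof -
  define first where "first = log_wave p (c p)"
  define rest where "rest = (\<Sum>k=2..N. log_wave (p ^ k) (c (p ^ k)))"
  have p: "p > 1" using assms by (rule prime_gt_1_nat)
  have split: "local_poly c N p = first + rest"
    unfolding local_poly_def first_def rest_def
    using N_pos by (subst sum.atLeast_Suc_atMost) (auto simp: numeral_2_eq_2)
  have "coef (local_poly c N p ^ 2) 0 - 2 * (c p)\<^sup>2 = coef (local_poly c N p ^ 2 - first ^ 2) 0"
    using coef_0_log_wave_squared[OF p] by (simp add: first_def lookup_minus)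
  also have "local_poly c N p ^ 2 - first ^ 2 = rest * (local_poly c N p + first)"
    unfolding split by (simp add: power2_eq_square algebra_simps)
  finally have "cmod (coef (local_poly c N p ^ 2) 0 - 2 * (c p)\<^sup>2)
      \<le> l1_norm (rest * (local_poly c N p + first))"
    by (simp only: norm_coef_le_l1_norm)
  also have "\<dots> \<le> l1_norm rest * l1_norm (local_poly c N p + first)"
    by (rule l1_norm_mult)
  also have "\<dots> \<le> (8 * A * ln (real p) * (1 / sqrt (real p)) ^ 2) * (majorant p + majorant p)"
  proof (intro mult_mono l1_norm_nonneg)
    show "l1_norm rest \<le> 8 * A * ln (real p) * (1 / sqrt (real p)) ^ 2"
      unfolding rest_def using assms by (rule l1_norm_local_tail_le) simp
    have "l1_norm first \<le> 2 * cmod (c p)"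
      unfolding first_def by (rule l1_norm_log_wave)
    also have "\<dots> \<le> 8 * (A * ln (real p) * (1 / sqrt (real p)))"
      using coeff_bound[OF assms, of 1] norm_ge_zero[of "c p"]
      by (simp only: power_one_right) linarith
    finally have "l1_norm first \<le> majorant p" by (simp add: majorant_def)
    then show "l1_norm (local_poly c N p + first) \<le> majorant p + majorant p"
      using l1_norm_add l1_norm_local_poly_le[OF assms] by (meson add_mono order_trans)
  qed (use A_nonneg p in simp)
  also have "\<dots> = 128 * A\<^sup>2 * (ln (real p) ^ 2 / (real p * sqrt (real p)))"
    by (simp add: majorant_def power2_eq_square field_simps)
  finally show ?thesis .
qed

lemma log_poly_variance_near_prime_sum:
  "cmod (log_poly_variance c N - (\<Sum>p | prime p \<and> p \<le> N. 2 * (c p)\<^sup>2))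
    \<le> 128 * ln_power_series 2 * A\<^sup>2"
proof -
  let ?P = "{p. prime p \<and> p \<le> N}"
  have "cmod (log_poly_variance c N - (\<Sum>p\<in>?P. 2 * (c p)\<^sup>2))
      \<le> (\<Sum>p\<in>?P. cmod (coef (local_poly c N p ^ 2) 0 - 2 * (c p)\<^sup>2))"
    unfolding log_poly_variance_def sum_subtractf[symmetric] by (rule norm_sum)
  also have "\<dots> \<le> (\<Sum>p\<in>?P. 128 * A\<^sup>2 * (ln (real p) ^ 2 / (real p * sqrt (real p))))"
    by (intro sum_mono local_variance_near_prime_term) simp
  also have "\<dots> \<le> 128 * A\<^sup>2 * ln_power_series 2"
    unfolding sum_distrib_left[symmetric] by (intro mult_left_mono sum_ln_power_over_le) auto
  finally show ?thesis by (simp add: mult_ac)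
qed

end

lemma moment_near_gauss_uniform:
  fixes M D :: real and m :: nat
  shows "\<exists>E. \<forall>c N A. prime_power_coeffs c N A \<longrightarrow> A \<le> M \<longrightarrow> A * ln (real N) \<le> D \<longrightarrow>
    cmod (coef (log_poly c N ^ m) 0 - fact m * fps_nth (gauss_fps (log_poly_variance c N)) m)
      \<le> E * A ^ 3"
proof -
  obtain C where mertens: "C \<ge> 0" "\<And>t. t \<ge> 0 \<Longrightarrow> \<bar>mertens_sum t - t\<bar> \<le> C"
    using mertens_first by blast
  define K where "K = real (m + 1) * (1 + 16 * M) ^ m"
  define E where "E = 2 * K * (512 * ln_power_series 3) * exp (K * (64 * (D * (D + M * C))))"
  have "cmod (coef (log_poly c N ^ m) 0 - fact m * fps_nth (gauss_fps (log_poly_variance c N)) m)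
      \<le> fact m * E * A ^ 3"
    if "prime_power_coeffs c N A" and A_bounds: "A \<le> M" "A * ln (real N) \<le> D" for c N A
  proof -
    interpret prime_power_coeffs c N A by fact
    let ?moment = "coef (log_poly c N ^ m) 0"
      and ?gauss = "fps_nth (gauss_fps (log_poly_variance c N)) m"
    have K_bounds: "real (m + 1) * (1 + 16 * A) ^ m \<le> K" "K \<ge> 0"
      unfolding K_def using A_bounds A_nonneg by (auto intro!: mult_left_mono power_mono)
    have "cmod (?moment / fact m - ?gauss)
        \<le> 2 * K * (512 * ln_power_series 3 * A ^ 3) * exp (K * (64 * (D * (D + M * C))))"
      using K_bounds A_nonneg
      by (intro order_trans[OF moment_near_gauss] mult_mono iffD2[OF exp_le_cancel_iff]
          sum_majorant_cubed_le sum_majorant_squared_le mertens A_bounds)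
         (auto intro!: sum_nonneg mult_nonneg_nonneg majorant_nonneg ln_power_series_nonneg)
    moreover have "?moment - fact m * ?gauss = fact m * (?moment / fact m - ?gauss)"
      by (simp add: right_diff_distrib)
    ultimately show ?thesis
      by (simp add: norm_mult E_def mult_ac)
  qed
  then show ?thesis by blast
qed

section \<open>The oscillating term\<close>

lemma eventually_powr_less_powr:
  fixes C s a :: real
  assumes "s < a"
  shows "\<forall>\<^sub>F T in at_top. C * T powr s < T powr a"
  using assms by real_asymp

context test_function
begin

definition cutoff :: "real \<Rightarrow> nat" where
  "cutoff L = nat \<lfloor>exp (\<alpha> * L)\<rfloor>"

definition osc_poly :: "real \<Rightarrow> (real \<Rightarrow>\<^sub>0 complex)" where
  "osc_poly L = log_poly (osc_coeff f L) (cutoff L)"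

definition osc_variance :: "real \<Rightarrow> complex" where
  "osc_variance L = log_poly_variance (osc_coeff f L) (cutoff L)"

lemma osc_coeff_eq_0:
  assumes "L > 0" "n > cutoff L"
  shows "osc_coeff f L n = 0"
proof -
  have "\<alpha> * L < ln (real n)"
    using le_nat_floor_exp_iff[of n "\<alpha> * L"] assms(2) by (simp add: cutoff_def)
  then have "fourier f (ln (real n) / L) = 0"
    using assms(1) by (intro fourier_eq_0) (simp add: field_simps abs_if)
  then show ?thesis by (simp add: osc_coeff_def)
qed

lemma N_osc_eq_trig_poly:
  assumes L_pos: "L > 0"
  shows "N_osc f (exp L) \<tau> = trig_poly (osc_poly L) \<tau>"
proof -
  let ?t = "\<lambda>n. (mangoldt n / complex_of_real (sqrt (real n))) * fourier f (ln (real n) / L) *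
    (exp (\<i> * complex_of_real (\<tau> * ln (real n))) +
     exp (- \<i> * complex_of_real (\<tau> * ln (real n))))"
  have summand: "- (1 / complex_of_real L) * ?t n = trig_poly (log_wave n (osc_coeff f L n)) \<tau>"
    for n
    using L_pos by (simp add: trig_poly_log_wave osc_coeff_def cis_conv_exp mult_ac)
  have "(\<Sum>\<^sub>\<infinity>n\<in>{2::nat..}. ?t n) = (\<Sum>\<^sub>\<infinity>n\<in>{..cutoff L}. ?t n)"
  proof (rule infsum_cong_neutral)
    fix n assume "n \<in> {2..} - {..cutoff L}"
    then have "- (1 / complex_of_real L) * ?t n = 0"
      unfolding summand using osc_coeff_eq_0[OF L_pos] by simp
    then show "?t n = 0" using L_pos by simp
  next
    fix n assume "n \<in> {..cutoff L} - {2..}"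
    then have "n = 0 \<or> n = 1" by auto
    then show "?t n = 0" by auto
  qed auto
  then have "N_osc f (exp L) \<tau> = (\<Sum>n\<le>cutoff L. - (1 / complex_of_real L) * ?t n)"
    by (simp add: N_osc_def sum_distrib_left)
  also have "\<dots> = trig_poly (osc_poly L) \<tau>"
    unfolding summand osc_poly_def log_poly_def trig_poly_sum ..
  finally show ?thesis .
qed

lemma wavg_N_osc_power:
  assumes L_pos: "L > 0" and "H > 0" and w_density: "integrable lborel w" "(LINT x|lborel. w x) = 1"
    and band: "\<And>u. \<bar>u\<bar> > B \<Longrightarrow> fourier w u = 0"
    and H_large: "H > 4 * pi * B * exp (\<alpha> * L * real m / 2)"
  shows "wavg w (exp L) H (\<lambda>\<tau>. N_osc f (exp L) \<tau> ^ m) = coef (osc_poly L ^ m) 0"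
  unfolding N_osc_eq_trig_poly[OF L_pos] trig_poly_power[symmetric]
proof (rule wavg_trig_poly_eq_coef_0[OF assms(2) w_density band])
  fix x assume x_freq: "x \<in> freqs (osc_poly L ^ m)" "x \<noteq> 0"
  have "real (cutoff L) \<le> exp (\<alpha> * L)" by (simp add: cutoff_def)
  then have "x \<in> log_ratios (exp (\<alpha> * L) ^ m)"
    using x_freq(1) freqs_log_poly_power[of "osc_coeff f L"] unfolding osc_poly_def
    by (auto simp: osc_coeff_def)
  moreover have "sqrt (exp (\<alpha> * L) ^ m) = exp (\<alpha> * L * real m / 2)"
    by (rule real_sqrt_unique) (simp_all add: mult_ac flip: exp_of_nat_mult exp_double)
  ultimately have "1 / (2 * exp (\<alpha> * L * real m / 2)) \<le> \<bar>x\<bar>"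
    using log_ratios_gap x_freq(2) by metis
  then have "H * (1 / (2 * exp (\<alpha> * L * real m / 2))) \<le> H * \<bar>x\<bar>"
    using assms(2) by (intro mult_left_mono) auto
  moreover have "2 * pi * B < H * (1 / (2 * exp (\<alpha> * L * real m / 2)))"
    using H_large by (simp add: pos_less_divide_eq mult_ac)
  ultimately show "H * \<bar>x\<bar> > 2 * pi * B" by linarith
qed

lemma eventually_wavg_N_osc_power:
  assumes w_density: "integrable lborel w" "(LINT x|lborel. w x) = 1"
    and band: "\<And>u. \<bar>u\<bar> > B \<Longrightarrow> fourier w u = 0"
    and gap: "\<alpha> * real m / 2 < a"
  shows "\<forall>\<^sub>F T in at_top.
    wavg w T (T powr a) (\<lambda>\<tau>. N_osc f T \<tau> ^ m) = coef (osc_poly (ln T) ^ m) 0"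
  using eventually_powr_less_powr[OF gap, of "4 * pi * B"] eventually_gt_at_top[of 1]
proof eventually_elim
  case (elim T)
  then show ?case
    using wavg_N_osc_power[of "ln T" "T powr a" w B m] w_density band
    by (simp add: powr_def mult_ac)
qed

lemma prime_power_coeffs_osc_coeff:
  assumes L_pos: "L > 0"
  shows "prime_power_coeffs (osc_coeff f L) (cutoff L) ((LINT x|lborel. \<bar>f x\<bar>) / L)"
proof
  show "cutoff L > 0"
    unfolding cutoff_def using \<alpha>_pos L_pos by (intro ln_nat_floor_exp_bounds) simp
  show "osc_coeff f L n = 0" if "n > cutoff L" for n
    using osc_coeff_eq_0[OF L_pos that] .
  show "osc_coeff f L n = 0" if "\<not> primepow n" for n
    using that by (simp add: osc_coeff_def mangoldt_def)
  fix p k :: nat assume p: "prime p" and "k > 0"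
  have "cmod (osc_coeff f L (p ^ k))
      = ln (real p) / (sqrt (real p) ^ k * L) * cmod (fourier f (ln (real (p ^ k)) / L))"
    using p \<open>k > 0\<close> L_pos prime_ge_1_nat[OF p]
    by (simp add: osc_coeff_def norm_mult norm_divide real_sqrt_power norm_power)
  also have "\<dots> \<le> ln (real p) / (sqrt (real p) ^ k * L) * (LINT x|lborel. \<bar>f x\<bar>)"
    using L_pos prime_ge_1_nat[OF p] by (intro mult_left_mono norm_fourier_le) auto
  finally show "cmod (osc_coeff f L (p ^ k))
      \<le> (LINT x|lborel. \<bar>f x\<bar>) / L * ln (real p) * (1 / sqrt (real p)) ^ k"
    by (simp add: power_one_over field_simps)
qed (use L_pos in simp)

lemma osc_variance_asymptotic:
  "(\<lambda>L. osc_variance L - sigma2 f) \<in> O(\<lambda>L. of_real (1 / L))"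
proof -
  let ?M = "LINT x|lborel. \<bar>f x\<bar>"
  let ?S = "\<lambda>L. \<Sum>p | prime p \<and> ln (real p) \<le> \<alpha> * L. 2 * (osc_coeff f L p)\<^sup>2"
  have "cmod (osc_variance L - ?S L) \<le> 128 * ln_power_series 2 * ?M\<^sup>2 * cmod (of_real (1 / L))"
    if L_ge_1: "L \<ge> 1" for L
  proof -
    interpret prime_power_coeffs "osc_coeff f L" "cutoff L" "?M / L"
      using L_ge_1 by (intro prime_power_coeffs_osc_coeff) simp
    have "cmod (osc_variance L - ?S L) \<le> 128 * ln_power_series 2 * (?M / L)\<^sup>2"
      using log_poly_variance_near_prime_sum
      by (simp add: osc_variance_def primes_ln_le_eq cutoff_def)
    also have "\<dots> = 128 * ln_power_series 2 * ?M\<^sup>2 * (1 / L\<^sup>2)"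
      by (simp add: power_divide)
    also have "\<dots> \<le> 128 * ln_power_series 2 * ?M\<^sup>2 * (1 / L)"
      using L_ge_1 by (intro mult_left_mono divide_left_mono)
        (auto simp: self_le_power intro!: mult_nonneg_nonneg ln_power_series_nonneg)
    finally show ?thesis
      using L_ge_1 by (simp add: norm_divide)
  qed
  then have "(\<lambda>L. osc_variance L - ?S L) \<in> O(\<lambda>L. of_real (1 / L))"
    by (intro bigoI[of _ "128 * ln_power_series 2 * ?M\<^sup>2"]
        eventually_mono[OF eventually_ge_at_top[of 1]])
  from sum_in_bigo(1)[OF this prime_variance_asymptotic] show ?thesis by simp
qed

lemma osc_moment_near_gauss:
  "(\<lambda>L. coef (osc_poly L ^ m) 0 - fact m * fps_nth (gauss_fps (osc_variance L)) m)
    \<in> O(\<lambda>L. of_real (1 / L))"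
proof -
  let ?M = "LINT x|lborel. \<bar>f x\<bar>"
  let ?d = "\<lambda>L. coef (osc_poly L ^ m) 0 - fact m * fps_nth (gauss_fps (osc_variance L)) m"
  obtain E where moment_bound: "\<And>c N A. prime_power_coeffs c N A \<Longrightarrow> A \<le> ?M \<Longrightarrow>
      A * ln (real N) \<le> ?M * \<alpha> \<Longrightarrow>
      cmod (coef (log_poly c N ^ m) 0 - fact m * fps_nth (gauss_fps (log_poly_variance c N)) m)
        \<le> E * A ^ 3"
    using moment_near_gauss_uniform by blast
  have "cmod (?d L) \<le> \<bar>E\<bar> * ?M ^ 3 * cmod (of_real (1 / L))" if L_ge_1: "L \<ge> 1" for L
  proof -
    have "?M / L \<le> ?M" using L_ge_1 divide_left_mono[of 1 L ?M] by simp
    moreover have "ln (real (cutoff L)) \<le> \<alpha> * L"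
      unfolding cutoff_def using \<alpha>_pos L_ge_1 by (intro ln_nat_floor_exp_bounds) simp
    then have "?M / L * ln (real (cutoff L)) \<le> ?M / L * (\<alpha> * L)"
      using L_ge_1 by (intro mult_left_mono) auto
    ultimately have "cmod (?d L) \<le> E * (?M / L) ^ 3"
      unfolding osc_poly_def osc_variance_def using L_ge_1
      by (intro moment_bound prime_power_coeffs_osc_coeff) auto
    also have "\<dots> \<le> \<bar>E\<bar> * ?M ^ 3 * (1 / L ^ 3)"
      using L_ge_1 by (auto simp: power_divide intro!: mult_right_mono divide_right_mono)
    also have "\<dots> \<le> \<bar>E\<bar> * ?M ^ 3 * (1 / L)"
      using L_ge_1 by (intro mult_left_mono divide_left_mono) (auto simp: self_le_power)
    finally show ?thesis using L_ge_1 by (simp add: norm_divide)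
  qed
  then show ?thesis
    by (intro bigoI[of _ "\<bar>E\<bar> * ?M ^ 3"] eventually_mono[OF eventually_ge_at_top[of 1]])
qed

lemma osc_moment_asymptotic:
  "(\<lambda>L. coef (osc_poly L ^ m) 0 - fact m * fps_nth (gauss_fps (sigma2 f)) m)
    \<in> O(\<lambda>L. of_real (1 / L))"
proof -
  have "(\<lambda>L. complex_of_real (1 / L)) \<in> O(\<lambda>_. 1)"
    by (intro bigoI[of _ 1] eventually_mono[OF eventually_ge_at_top[of 1]]) (simp add: norm_divide)
  then have "(\<lambda>L. fps_nth (gauss_fps (osc_variance L)) m - fps_nth (gauss_fps (sigma2 f)) m)
      \<in> O(\<lambda>L. of_real (1 / L))"
    by (rule gauss_fps_nth_diff_bigo[OF osc_variance_asymptotic])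
  then have "(\<lambda>L. fact m *
      (fps_nth (gauss_fps (osc_variance L)) m - fps_nth (gauss_fps (sigma2 f)) m))
      \<in> O(\<lambda>L. of_real (1 / L))"
    by simp
  from sum_in_bigo(1)[OF osc_moment_near_gauss[of m] this] show ?thesis
    by (simp add: right_diff_distrib)
qed

end

theorem theorem7:
  fixes a \<alpha> :: real and f w :: "real \<Rightarrow> real" and m :: nat
  assumes a_pos: "0 < a" and a_le: "a \<le> 1"
    and alpha_pos: "\<alpha> > 0"
    and f_int: "integrable lborel f"
    and f_even: "\<And>x. f (- x) = f x"
    and f_smooth: "smooth_fun (fourier f)"
    and f_supp: "supp (fourier f) \<subseteq> {- \<alpha><..<\<alpha>}"
    and w_nonneg: "\<And>x. w x \<ge> 0"
    and w_int: "integrable lborel w"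
    and w_one: "(LINT x|lborel. w x) = 1"
    and w_supp: "bounded (supp (fourier w))"
    and m_ge: "2 \<le> m" and m_lt: "real m < 2 * a / \<alpha>"
  shows "\<exists>C. \<forall>\<^sub>F T in at_top.
           cmod (wavg w T (T powr a) (\<lambda>\<tau>. (N_osc f T \<tau>) ^ m)
                 - (if even m
                    then complex_of_real (fact m / (fact (m div 2) * 2 ^ (m div 2))) * (sigma2 f) ^ (m div 2)
                    else 0))
           \<le> C / ln T"
proof -
  have gap: "\<alpha> * real m / 2 < a"
    using m_lt alpha_pos by (simp add: field_simps)
  moreover have "\<alpha> * 2 \<le> \<alpha> * real m"
    using m_ge alpha_pos by simp
  ultimately have "\<alpha> \<le> 1"
    using a_le by linarith
  interpret test_function f \<alpha>
    by unfold_locales (fact alpha_pos \<open>\<alpha> \<le> 1\<close> f_even f_smooth f_supp)+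
  obtain B where band: "\<And>u. \<bar>u\<bar> > B \<Longrightarrow> fourier w u = 0"
    using w_supp eq_0_if_notin_supp[of _ "fourier w"] unfolding bounded_real
    by (meson linorder_not_le)
  have average: "\<forall>\<^sub>F T in at_top.
      wavg w T (T powr a) (\<lambda>\<tau>. (N_osc f T \<tau>) ^ m) = coef (osc_poly (ln T) ^ m) 0"
    by (rule eventually_wavg_N_osc_power[OF w_int w_one band gap])
  have "(\<lambda>T. coef (osc_poly (ln T) ^ m) 0 - fact m * fps_nth (gauss_fps (sigma2 f)) m)
      \<in> O(\<lambda>T. of_real (1 / ln T))"
    by (rule landau_o.big.compose[OF osc_moment_asymptotic ln_at_top])
  then obtain C where "\<forall>\<^sub>F T in at_top.
      cmod (coef (osc_poly (ln T) ^ m) 0 - fact m * fps_nth (gauss_fps (sigma2 f)) m)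
        \<le> C * cmod (of_real (1 / ln T))"
    by (rule landau_o.bigE)
  with average eventually_gt_at_top[of 1] show ?thesis
    unfolding fact_mult_gauss_fps_nth[symmetric]
    by (intro exI[of _ C], eventually_elim) (simp add: norm_divide)
qed

end
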